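(* Let $E$ be a directed graph not satisfying Condition (L). Then there exist an $E$-branching system $\{R_e,D_v,f_e\}_{e\in E^1,v\in E^0}$ on a $\sigma$-finite measure space $(X,\mu)$, with induced representation $\pi:C^*(E)\to B(L^2(X,\mu))$, such that $\pi(p_v)\neq 0$ for all $v\in E^0$ and $\pi$ is not faithful (not injective).
   Context: A directed graph $E=(E^0,E^1,r,s)$ consists of two countable sets $E^0$ (vertices), $E^1$ (edges) and maps $r,s:E^1\to E^0$; an edge $e$ points from $s(e)$ to $r(e)$. For $n\ge 1$, a path of length $n$ is a tuple $(\alpha_1,\dots,\alpha_n)$ of edges with $r(\alpha_i)=s(\alpha_{i+1})$ for $1\le i\le n-1$. It is a cycle if $s(\alpha_1)=r(\alpha_n)$. A cycle has no exits if $s^{-1}(s(\alpha_i))=\{\alpha_i\}$ for all $i$; otherwise it has an exit. $E$ satisfies Condition (L) if every cycle of $E$ has an exit. The graph C*-algebra $C^*(E)$ is the universal C*-algebra generated by partial isometries $\{s_e:e\in E^1\}$ with mutually orthogonal ranges and mutually orthogonal projections $\{p_v:v\in E^0\}$ satisfying: (1) $s_e^*s_e=p_{r(e)}$ for all $e\in E^1$; (2) $s_es_e^*\le p_{s(e)}$ for all $e\in E^1$; (3) $p_v=\sum_{s(e)=v}s_es_e^*$ whenever $0<|s^{-1}(v)|<\infty$. An $E$-branching system on a measure space $(X,\mu)$ is a family $\{R_e,D_v,f_e\}_{e\in E^1,v\in E^0}$, where $R_e,D_v$ are measurable subsets of $X$, such that (all set relations holding up to $\mu$-null sets): (1) $R_e\cap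 R_f=\emptyset$ if $e\ne f$; (2) $D_v\cap D_w=\emptyset$ if $v\ne w$; (3) $R_e\subseteq D_{s(e)}$ for all $e$; (4) $D_v=\bigcup_{e\in s^{-1}(v)}R_e$ if $0<|s^{-1}(v)|<\infty$; (5) for each $e\in E^1$ there are measurable maps $f_e:D_{r(e)}\to R_e$ and $f_e^{-1}:R_e\to D_{r(e)}$ with $f_e\circ f_e^{-1}=\mathrm{id}_{R_e}$ and $f_e^{-1}\circ f_e=\mathrm{id}_{D_{r(e)}}$ $\mu$-a.e., such that the pushforward measure $\mu\circ f_e$ of $\mu|_{R_e}$ under $f_e^{-1}$ is absolutely continuous with respect to $\mu$ on $D_{r(e)}$, and the pushforward measure $\mu\circ f_e^{-1}$ of $\mu|_{D_{r(e)}}$ under $f_e$ is absolutely continuous with respect to $\mu$ on $R_e$. Write $\Phi_{f_e^{-1}}=d(\mu\circ f_e^{-1})/d\mu$ for the Radon-Nikodym derivative. The representation induced from the branching system is the unique $*$-homomorphism $\pi:C^*(E)\to B(L^2(X,\mu))$ such that $\pi(s_e)(\phi)=\Phi_{f_e^{-1}}^{1/2}(\phi\circ f_e^{-1})$ (understood as $0$ outside $R_e$) and $\pi(p_v)(\phi)=\chi_{D_v}\phi$ for all $e\in E^1$, $v\in E^0$, $\phi\in L^2(X,\mu)$; its existence is a known fact. *)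

theory Defs
  imports "HOL-Probability.Probability" "HOL-Algebra.Module" "Graph_Theory.Arc_Walk"
begin

section \<open>Directed graphs and Condition (L)\<close>

text \<open>
  A directed graph is a \<^locale>\<open>wf_digraph\<close> with countably many vertices and arcs; the source and
  range maps are \<^const>\<open>tail\<close> and \<^const>\<open>head\<close>, and the set of edges emitted by a vertex is
  \<^const>\<open>out_arcs\<close>. Loops and parallel edges are allowed.
\<close>

definition countable_digraph :: "('v, 'e) pre_digraph \<Rightarrow> bool" where
  "countable_digraph G \<longleftrightarrow> wf_digraph G \<and> countable (verts G) \<and> countable (arcs G)"

text \<open>
  A cycle is any closed path of positive length, possibly with repeated vertices, i.e.
  \<^const>\<open>wf_digraph.closed_w\<close> rather than \<^const>\<open>pre_digraph.cycle\<close>.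
\<close>

definition has_exit :: "('v, 'e) pre_digraph \<Rightarrow> 'e list \<Rightarrow> bool" where
  "has_exit G \<alpha> \<longleftrightarrow> \<not> (\<forall>e\<in>set \<alpha>. out_arcs G (tail G e) = {e})"

definition condition_L :: "('v, 'e) pre_digraph \<Rightarrow> bool" where
  "condition_L G \<longleftrightarrow> (\<forall>\<alpha>. wf_digraph.closed_w G \<alpha> \<longrightarrow> has_exit G \<alpha>)"


section \<open>C*-algebras\<close>

text \<open>
  C*-algebras are not assumed to be unital, so that the field \<^const>\<open>one\<close> inherited from the
  ring record carries no meaning here and occurs in no axiom.
\<close>

record 'a cstar = "(complex, 'a) module" +
  star :: "'a \<Rightarrow> 'a"
  cnorm :: "'a \<Rightarrow> real"

definition cdist :: "'a cstar \<Rightarrow> 'a \<Rightarrow> 'a \<Rightarrow> real" where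
  "cdist A x y = cnorm A (x \<ominus>\<^bsub>A\<^esub> y)"

locale cstar_algebra = abelian_group A for A :: "'a cstar" (structure) +
  assumes smult_closed: "x \<in> carrier A \<Longrightarrow> c \<odot> x \<in> carrier A"
    and smult_add_left: "x \<in> carrier A \<Longrightarrow> (c + d) \<odot> x = c \<odot> x \<oplus> d \<odot> x"
    and smult_add_right: "x \<in> carrier A \<Longrightarrow> y \<in> carrier A \<Longrightarrow> c \<odot> (x \<oplus> y) = c \<odot> x \<oplus> c \<odot> y"
    and smult_smult: "x \<in> carrier A \<Longrightarrow> (c * d) \<odot> x = c \<odot> (d \<odot> x)"
    and smult_one: "x \<in> carrier A \<Longrightarrow> 1 \<odot> x = x"
    and mult_closed: "x \<in> carrier A \<Longrightarrow> y \<in> carrier A \<Longrightarrow> x \<otimes> y \<in> carrier A"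
    and mult_assoc: "x \<in> carrier A \<Longrightarrow> y \<in> carrier A \<Longrightarrow> z \<in> carrier A \<Longrightarrow>
      (x \<otimes> y) \<otimes> z = x \<otimes> (y \<otimes> z)"
    and distrib_right: "x \<in> carrier A \<Longrightarrow> y \<in> carrier A \<Longrightarrow> z \<in> carrier A \<Longrightarrow>
      (x \<oplus> y) \<otimes> z = x \<otimes> z \<oplus> y \<otimes> z"
    and distrib_left: "x \<in> carrier A \<Longrightarrow> y \<in> carrier A \<Longrightarrow> z \<in> carrier A \<Longrightarrow>
      z \<otimes> (x \<oplus> y) = z \<otimes> x \<oplus> z \<otimes> y"
    and smult_mult_left: "x \<in> carrier A \<Longrightarrow> y \<in> carrier A \<Longrightarrow> (c \<odot> x) \<otimes> y = c \<odot> (x \<otimes> y)"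
    and smult_mult_right: "x \<in> carrier A \<Longrightarrow> y \<in> carrier A \<Longrightarrow> x \<otimes> (c \<odot> y) = c \<odot> (x \<otimes> y)"
    and star_closed: "x \<in> carrier A \<Longrightarrow> star A x \<in> carrier A"
    and star_star: "x \<in> carrier A \<Longrightarrow> star A (star A x) = x"
    and star_add: "x \<in> carrier A \<Longrightarrow> y \<in> carrier A \<Longrightarrow> star A (x \<oplus> y) = star A x \<oplus> star A y"
    and star_smult: "x \<in> carrier A \<Longrightarrow> star A (c \<odot> x) = cnj c \<odot> star A x"
    and star_mult: "x \<in> carrier A \<Longrightarrow> y \<in> carrier A \<Longrightarrow> star A (x \<otimes> y) = star A y \<otimes> star A x"
    and norm_nonneg: "x \<in> carrier A \<Longrightarrow> 0 \<le> cnorm A x"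
    and norm_eq_zero: "x \<in> carrier A \<Longrightarrow> cnorm A x = 0 \<longleftrightarrow> x = \<zero>"
    and norm_triangle: "x \<in> carrier A \<Longrightarrow> y \<in> carrier A \<Longrightarrow> cnorm A (x \<oplus> y) \<le> cnorm A x + cnorm A y"
    and norm_smult: "x \<in> carrier A \<Longrightarrow> cnorm A (c \<odot> x) = cmod c * cnorm A x"
    and norm_mult: "x \<in> carrier A \<Longrightarrow> y \<in> carrier A \<Longrightarrow> cnorm A (x \<otimes> y) \<le> cnorm A x * cnorm A y"
    and cstar_identity: "x \<in> carrier A \<Longrightarrow> cnorm A (star A x \<otimes> x) = (cnorm A x)\<^sup>2"
    and complete: "Metric_space.mcomplete (carrier A) (cdist A)"

text \<open>The order of a C*-algebra: the positive elements are those of the form \<open>c\<^sup>* c\<close>.\<close>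

definition cstar_le :: "'a cstar \<Rightarrow> 'a \<Rightarrow> 'a \<Rightarrow> bool" where
  "cstar_le A x y \<longleftrightarrow> x \<in> carrier A \<and> y \<in> carrier A \<and>
     (\<exists>c\<in>carrier A. y \<ominus>\<^bsub>A\<^esub> x = star A c \<otimes>\<^bsub>A\<^esub> c)"

definition projection :: "'a cstar \<Rightarrow> 'a \<Rightarrow> bool" where
  "projection A p \<longleftrightarrow> p \<in> carrier A \<and> star A p = p \<and> p \<otimes>\<^bsub>A\<^esub> p = p"

definition partial_isometry :: "'a cstar \<Rightarrow> 'a \<Rightarrow> bool" where
  "partial_isometry A s \<longleftrightarrow> s \<in> carrier A \<and> s \<otimes>\<^bsub>A\<^esub> star A s \<otimes>\<^bsub>A\<^esub> s = s"

definition range_proj :: "'a cstar \<Rightarrow> 'a \<Rightarrow> 'a" where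
  "range_proj A s = s \<otimes>\<^bsub>A\<^esub> star A s"

definition generated_by :: "'a cstar \<Rightarrow> 'a set \<Rightarrow> bool" where
  "generated_by A X \<longleftrightarrow> X \<subseteq> carrier A \<and>
     (\<forall>S. X \<subseteq> S \<and> S \<subseteq> carrier A \<and> \<zero>\<^bsub>A\<^esub> \<in> S \<and>
          (\<forall>x\<in>S. \<forall>y\<in>S. x \<oplus>\<^bsub>A\<^esub> y \<in> S \<and> x \<otimes>\<^bsub>A\<^esub> y \<in> S) \<and>
          (\<forall>x\<in>S. star A x \<in> S \<and> (\<forall>c. c \<odot>\<^bsub>A\<^esub> x \<in> S)) \<and>
          closedin (Metric_space.mtopology (carrier A) (cdist A)) S
        \<longrightarrow> S = carrier A)"

text \<open>*-homomorphisms are extensional functions, so that uniqueness is uniqueness on the carrier.\<close>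

definition star_hom :: "'a cstar \<Rightarrow> 'b cstar \<Rightarrow> ('a \<Rightarrow> 'b) set" where
  "star_hom A B = {\<pi> \<in> carrier A \<rightarrow>\<^sub>E carrier B.
     (\<forall>x\<in>carrier A. \<forall>y\<in>carrier A.
        \<pi> (x \<oplus>\<^bsub>A\<^esub> y) = \<pi> x \<oplus>\<^bsub>B\<^esub> \<pi> y \<and> \<pi> (x \<otimes>\<^bsub>A\<^esub> y) = \<pi> x \<otimes>\<^bsub>B\<^esub> \<pi> y) \<and>
     (\<forall>x\<in>carrier A. \<pi> (star A x) = star B (\<pi> x) \<and> (\<forall>c. \<pi> (c \<odot>\<^bsub>A\<^esub> x) = c \<odot>\<^bsub>B\<^esub> \<pi> x))}"


section \<open>The graph C*-algebra\<close>

definition ck_family ::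
  "('v, 'e) pre_digraph \<Rightarrow> 'a cstar \<Rightarrow> ('v \<Rightarrow> 'a) \<Rightarrow> ('e \<Rightarrow> 'a) \<Rightarrow> bool" where
  "ck_family G A p s \<longleftrightarrow>
     (\<forall>e\<in>arcs G. partial_isometry A (s e)) \<and>
     (\<forall>e\<in>arcs G. \<forall>f\<in>arcs G. e \<noteq> f \<longrightarrow>
        range_proj A (s e) \<otimes>\<^bsub>A\<^esub> range_proj A (s f) = \<zero>\<^bsub>A\<^esub>) \<and>
     (\<forall>v\<in>verts G. projection A (p v)) \<and>
     (\<forall>v\<in>verts G. \<forall>w\<in>verts G. v \<noteq> w \<longrightarrow> p v \<otimes>\<^bsub>A\<^esub> p w = \<zero>\<^bsub>A\<^esub>) \<and>
     (\<forall>e\<in>arcs G. star A (s e) \<otimes>\<^bsub>A\<^esub> s e = p (head G e)) \<and>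
     (\<forall>e\<in>arcs G. cstar_le A (range_proj A (s e)) (p (tail G e))) \<and>
     (\<forall>v\<in>verts G. out_arcs G v \<noteq> {} \<and> finite (out_arcs G v) \<longrightarrow>
        p v = (\<Oplus>\<^bsub>A\<^esub>e\<in>out_arcs G v. range_proj A (s e)))"

text \<open>
  \<open>(A, p, s)\<close> is the universal C*-algebra generated by a family satisfying the defining relations
  of the graph algebra. HOL cannot quantify over types inside a formula, so universality is tested
  against the C*-algebras whose carrier lies in a given type \<open>'b\<close>. As the graph is countable, the
  C*-algebra generated by such a family has at most continuum many elements; hence, for every type
  \<open>'b\<close> with at least continuum many elements, this is the usual universal property and determines
  \<open>(A, p, s)\<close> up to isomorphism. As a hypothesis, universality with respect to one type \<open>'b\<close> is in
  any case implied by universality with respect to all C*-algebras.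
\<close>

definition graph_cstar_algebra ::
  "'b itself \<Rightarrow> ('v, 'e) pre_digraph \<Rightarrow> 'a cstar \<Rightarrow> ('v \<Rightarrow> 'a) \<Rightarrow> ('e \<Rightarrow> 'a) \<Rightarrow> bool" where
  "graph_cstar_algebra TYPE('b) G A p s \<longleftrightarrow>
     cstar_algebra A \<and> ck_family G A p s \<and> generated_by A (p ` verts G \<union> s ` arcs G) \<and>
     (\<forall>(B :: 'b cstar) q t. cstar_algebra B \<and> ck_family G B q t \<longrightarrow>
        (\<exists>!\<pi>. \<pi> \<in> star_hom A B \<and> (\<forall>v\<in>verts G. \<pi> (p v) = q v) \<and> (\<forall>e\<in>arcs G. \<pi> (s e) = t e)))"


section \<open>The Hilbert space of square-integrable functions and its bounded operators\<close>

definition L2_fun :: "'x measure \<Rightarrow> ('x \<Rightarrow> complex) set" where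
  "L2_fun M = {\<phi> \<in> borel_measurable M. integrable M (\<lambda>x. (cmod (\<phi> x))\<^sup>2)}"

definition L2_rel :: "'x measure \<Rightarrow> (('x \<Rightarrow> complex) \<times> ('x \<Rightarrow> complex)) set" where
  "L2_rel M = {(\<phi>, \<psi>). \<phi> \<in> L2_fun M \<and> \<psi> \<in> L2_fun M \<and> (AE x in M. \<phi> x = \<psi> x)}"

definition L2 :: "'x measure \<Rightarrow> ('x \<Rightarrow> complex) set set" where
  "L2 M = L2_fun M // L2_rel M"

definition L2_class :: "'x measure \<Rightarrow> ('x \<Rightarrow> complex) \<Rightarrow> ('x \<Rightarrow> complex) set" where
  "L2_class M \<phi> = L2_rel M `` {\<phi>}"

definition L2_rep :: "('x \<Rightarrow> complex) set \<Rightarrow> 'x \<Rightarrow> complex" where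
  "L2_rep U = (SOME \<phi>. \<phi> \<in> U)"

definition L2_add :: "'x measure \<Rightarrow> ('x \<Rightarrow> complex) set \<Rightarrow> ('x \<Rightarrow> complex) set \<Rightarrow> ('x \<Rightarrow> complex) set" where
  "L2_add M U V = L2_class M (\<lambda>x. L2_rep U x + L2_rep V x)"

definition L2_scale :: "'x measure \<Rightarrow> complex \<Rightarrow> ('x \<Rightarrow> complex) set \<Rightarrow> ('x \<Rightarrow> complex) set" where
  "L2_scale M c U = L2_class M (\<lambda>x. c * L2_rep U x)"

definition L2_inner :: "'x measure \<Rightarrow> ('x \<Rightarrow> complex) set \<Rightarrow> ('x \<Rightarrow> complex) set \<Rightarrow> complex" where
  "L2_inner M U V = (\<integral>x. L2_rep U x * cnj (L2_rep V x) \<partial>M)"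

definition L2_norm :: "'x measure \<Rightarrow> ('x \<Rightarrow> complex) set \<Rightarrow> real" where
  "L2_norm M U = sqrt (\<integral>x. (cmod (L2_rep U x))\<^sup>2 \<partial>M)"

type_synonym 'x L2_op = "('x \<Rightarrow> complex) set \<Rightarrow> ('x \<Rightarrow> complex) set"

definition bounded_ops :: "'x measure \<Rightarrow> 'x L2_op set" where
  "bounded_ops M = {T \<in> L2 M \<rightarrow>\<^sub>E L2 M.
     (\<forall>U\<in>L2 M. \<forall>V\<in>L2 M. T (L2_add M U V) = L2_add M (T U) (T V)) \<and>
     (\<forall>U\<in>L2 M. \<forall>c. T (L2_scale M c U) = L2_scale M c (T U)) \<and>
     (\<exists>C. \<forall>U\<in>L2 M. L2_norm M (T U) \<le> C * L2_norm M U)}"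

definition op_adjoint :: "'x measure \<Rightarrow> 'x L2_op \<Rightarrow> 'x L2_op" where
  "op_adjoint M T = (THE S. S \<in> bounded_ops M \<and>
     (\<forall>U\<in>L2 M. \<forall>V\<in>L2 M. L2_inner M (T U) V = L2_inner M U (S V)))"

definition L2_operators :: "'x measure \<Rightarrow> 'x L2_op cstar" where
  "L2_operators M = \<lparr>
     carrier = bounded_ops M,
     mult = (\<lambda>S T. \<lambda>U\<in>L2 M. S (T U)),
     one = (\<lambda>U\<in>L2 M. U),
     zero = (\<lambda>U\<in>L2 M. L2_class M (\<lambda>x. 0)),
     add = (\<lambda>S T. \<lambda>U\<in>L2 M. L2_add M (S U) (T U)),
     smult = (\<lambda>c T. \<lambda>U\<in>L2 M. L2_scale M c (T U)),
     star = op_adjoint M,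
     cnorm = (\<lambda>T. SUP U\<in>{U \<in> L2 M. L2_norm M U \<le> 1}. L2_norm M (T U))\<rparr>"


section \<open>Branching systems and the induced representation\<close>

text \<open>
  Here \<open>f e\<close> maps \<open>D (head G e)\<close> to \<open>R e\<close> and \<open>g e\<close> plays the role of \<open>f\<^sub>e\<^sup>-\<^sup>1\<close>. Both have to be
  genuinely measurable maps between the restricted spaces, but are inverse to each other only
  almost everywhere.
\<close>

definition branching_system ::
  "('v, 'e) pre_digraph \<Rightarrow> 'x measure \<Rightarrow> ('e \<Rightarrow> 'x set) \<Rightarrow> ('v \<Rightarrow> 'x set) \<Rightarrow>
     ('e \<Rightarrow> 'x \<Rightarrow> 'x) \<Rightarrow> ('e \<Rightarrow> 'x \<Rightarrow> 'x) \<Rightarrow> bool" where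
  "branching_system G M R D f g \<longleftrightarrow>
     (\<forall>e\<in>arcs G. R e \<in> sets M) \<and>
     (\<forall>v\<in>verts G. D v \<in> sets M) \<and>
     (\<forall>e\<in>arcs G. \<forall>e'\<in>arcs G. e \<noteq> e' \<longrightarrow> R e \<inter> R e' \<in> null_sets M) \<and>
     (\<forall>v\<in>verts G. \<forall>w\<in>verts G. v \<noteq> w \<longrightarrow> D v \<inter> D w \<in> null_sets M) \<and>
     (\<forall>e\<in>arcs G. R e - D (tail G e) \<in> null_sets M) \<and>
     (\<forall>v\<in>verts G. out_arcs G v \<noteq> {} \<and> finite (out_arcs G v) \<longrightarrow>
        sym_diff (D v) (\<Union>e\<in>out_arcs G v. R e) \<in> null_sets M) \<and>
     (\<forall>e\<in>arcs G. let MR = restrict_space M (R e); MD = restrict_space M (D (head G e)) in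
        f e \<in> measurable MD MR \<and> g e \<in> measurable MR MD \<and>
        (AE x in MR. f e (g e x) = x) \<and> (AE x in MD. g e (f e x) = x) \<and>
        absolutely_continuous MD (distr MR MD (g e)) \<and>
        absolutely_continuous MR (distr MD MR (f e)))"

text \<open>The Radon-Nikodym derivative \<open>d(\<mu> \<circ> f\<^sub>e\<^sup>-\<^sup>1) / d\<mu>\<close>, taken on \<open>R e\<close>.\<close>

definition branching_RN ::
  "('v, 'e) pre_digraph \<Rightarrow> 'x measure \<Rightarrow> ('e \<Rightarrow> 'x set) \<Rightarrow> ('v \<Rightarrow> 'x set) \<Rightarrow>
     ('e \<Rightarrow> 'x \<Rightarrow> 'x) \<Rightarrow> 'e \<Rightarrow> 'x \<Rightarrow> real" where
  "branching_RN G M R D f e x = enn2real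
     (RN_deriv (restrict_space M (R e))
        (distr (restrict_space M (D (head G e))) (restrict_space M (R e)) (f e)) x)"

definition induced_representation ::
  "('v, 'e) pre_digraph \<Rightarrow> 'a cstar \<Rightarrow> ('v \<Rightarrow> 'a) \<Rightarrow> ('e \<Rightarrow> 'a) \<Rightarrow>
     'x measure \<Rightarrow> ('e \<Rightarrow> 'x set) \<Rightarrow> ('v \<Rightarrow> 'x set) \<Rightarrow> ('e \<Rightarrow> 'x \<Rightarrow> 'x) \<Rightarrow> ('e \<Rightarrow> 'x \<Rightarrow> 'x) \<Rightarrow>
     ('a \<Rightarrow> 'x L2_op) \<Rightarrow> bool" where
  "induced_representation G A p s M R D f g \<pi> \<longleftrightarrow>
     \<pi> \<in> star_hom A (L2_operators M) \<and>
     (\<forall>e\<in>arcs G. \<forall>\<phi>\<in>L2_fun M. \<pi> (s e) (L2_class M \<phi>) =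
        L2_class M (\<lambda>x. if x \<in> R e
          then complex_of_real (sqrt (branching_RN G M R D f e x)) * \<phi> (g e x) else 0)) \<and>
     (\<forall>v\<in>verts G. \<forall>\<phi>\<in>L2_fun M. \<pi> (p v) (L2_class M \<phi>) =
        L2_class M (\<lambda>x. indicator (D v) x * \<phi> x))"

end

(*
  Each vertex v gets a countably infinite block of integers, and the block of v is split, for the
  edges e leaving v, into copies of the blocks of the ranges. If v emits a single edge, the splitting
  is the identity on the block, so around a cycle alpha without exits the maps f_e compose to the
  identity and s_alpha and p_v have the same image under the induced representation. They differ
  in C*(E): multiplying all s_e by a number z of modulus one with z^n = -1, where n is the length
  of alpha, gives another representation, which sends s_alpha to -p_v.
*)
theory Submission
  imports Defs
begin

section \<open>Adjoints in Hilbert spaces\<close>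

text \<open>Universality may be applied only to C*-algebras whose carrier lies in the type
  \<open>real L2_op\<close>. The induced representation and the twisted one that separates s_alpha
  from p_v therefore take values in the same algebra: the operators on L2 of counting measure on the
  natural numbers, viewed inside the reals. Much of the proof shows that, up to values outside the
  carrier, this is a C*-algebra, by identifying it through \<open>op_of\<close> with the
  complex-linear bounded operators on square-summable sequences. Existence and uniqueness of the
  induced representation then also come from universality. Counting measure makes only the empty set
  null, and the bijections f_e have Radon-Nikodym derivative 1. Blocks are infinite because a
  countably infinite set splits into any nonzero countable number of copies of itself, so one block
  size fits every vertex, infinite emitters included. The twist plays the role of the gauge
  action.\<close>

lemma riesz_representation:
  fixes f :: "'a::{real_inner, complete_space} \<Rightarrow> real"
  assumes "bounded_linear f"
  shows "\<exists>y. \<forall>x. f x = y \<bullet> x"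
proof -
  interpret f: bounded_linear f by fact
  \<comment> \<open>If f is the inner product with y, then \<open>q x\<close> is the squared
    distance from x to y minus the constant \<open>y \<bullet> y\<close>. So the representing vector
    is sought as the minimizer of q.\<close>
  define q where "q x = x \<bullet> x - 2 * f x" for x
  obtain K where K: "\<And>x. norm (f x) \<le> norm x * K" using f.bounded by blast
  have "- (K\<^sup>2) \<le> q x" for x
  proof -
    have "f x \<le> norm x * K" using K[of x] by auto
    moreover have "0 \<le> (norm x - K)\<^sup>2" by simp
    ultimately show ?thesis
      unfolding q_def power2_norm_eq_inner[symmetric] by (simp add: power2_diff)
  qed
  then have bdd: "bdd_below (range q)" by (intro bdd_belowI[where m = "- (K\<^sup>2)"]) auto
  define m where "m = Inf (range q)"
  have m: "m \<le> q x" for x unfolding m_def by (rule cInf_lower) (auto simp: bdd)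
  have "\<exists>x. q x < m + 1 / real (Suc n)" for n
    using cInf_lessD[of "range q" "m + 1 / real (Suc n)"] unfolding m_def by auto
  then obtain X where X: "\<And>n. q (X n) < m + 1 / real (Suc n)" by metis
  \<comment> \<open>The parallelogram law; the linear part of q cancels because the midpoint is
    counted twice. As q is at least m at the midpoint, two near-minimizers are close to each
    other.\<close>
  have par: "q x + q y - 2 * q ((1/2) *\<^sub>R (x + y)) = (norm (x - y))\<^sup>2 / 2" for x y
    unfolding q_def power2_norm_eq_inner
    by (simp add: f.add f.scaleR inner_add inner_diff inner_commute field_simps)
  have close: "(norm (X i - X j))\<^sup>2 \<le> 2 * (1 / real (Suc i) + 1 / real (Suc j))" for i j
  proof -
    have *: "d / 2 = a + b - 2 * c \<Longrightarrow> m \<le> c \<Longrightarrow> a < m + r \<Longrightarrow> b < m + s \<Longrightarrow> d \<le> 2 * (r + s)"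
      for a b c d r s :: real by argo
    show ?thesis by (rule *[OF par[symmetric] m X X])
  qed
  have "Cauchy X"
  proof (rule metric_CauchyI)
    fix e :: real assume "0 < e"
    then obtain N where N: "1 / real (Suc N) < e\<^sup>2 / 4"
      using nat_approx_posE[of "e\<^sup>2 / 4"] by auto
    show "\<exists>M. \<forall>i\<ge>M. \<forall>j\<ge>M. dist (X i) (X j) < e"
    proof (intro exI[of _ N] allI impI)
      fix i j assume "N \<le> i" "N \<le> j"
      then have "1 / real (Suc i) \<le> 1 / real (Suc N)" "1 / real (Suc j) \<le> 1 / real (Suc N)"
        by (auto simp: field_simps)
      with close[of i j] N have "(norm (X i - X j))\<^sup>2 < e\<^sup>2" by argo
      then show "dist (X i) (X j) < e"
        using \<open>0 < e\<close> by (simp add: dist_norm power2_less_imp_less)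
    qed
  qed
  then obtain y where y: "X \<longlonglongrightarrow> y"
    using Cauchy_convergent convergent_def by blast
  have lim: "(\<lambda>n. q (X n)) \<longlonglongrightarrow> q y"
    unfolding q_def by (intro tendsto_intros f.tendsto y)
  have lim': "(\<lambda>n. m + 1 / real (Suc n)) \<longlonglongrightarrow> m + 0"
    by (intro tendsto_intros LIMSEQ_Suc lim_1_over_n)
  have qy: "q y \<le> m"
    using LIMSEQ_le[OF lim lim'] X less_imp_le by auto
  have "f x = y \<bullet> x" for x
  proof -
    define a where "a = y \<bullet> x - f x"
    define s where "s = x \<bullet> x"
    \<comment> \<open>Minimality of y is tested in direction x, where q changes by a quadratic
      polynomial in t. The optimal t would be -a/s; the denominator s + 1 stays positive also for x
      = 0 and still makes the change negative unless a = 0.\<close>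
    define t where "t = - a / (s + 1)"
    have s: "0 \<le> s" by (simp add: s_def)
    have "q (y + t *\<^sub>R x) = q y + 2 * t * a + t * t * s"
      unfolding q_def a_def s_def
      by (simp add: f.add f.scaleR inner_add inner_commute algebra_simps)
    then have "0 \<le> 2 * t * a + t * t * s"
      using m[of "y + t *\<^sub>R x"] qy by linarith
    also have "\<dots> = - (a\<^sup>2 * (s + 2)) / (s + 1)\<^sup>2"
      using s by (simp add: t_def power2_eq_square divide_simps) (simp add: algebra_simps)
    finally have "0 \<le> - (a\<^sup>2 * (s + 2)) / (s + 1)\<^sup>2" .
    moreover have "0 < (s + 1)\<^sup>2" using s by simp
    ultimately have "0 \<le> - (a\<^sup>2 * (s + 2))" by (simp only: pos_le_divide_eq mult_zero_left)
    then have "a\<^sup>2 * (s + 2) \<le> 0" by simp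
    then have "a = 0" using s by (simp add: mult_le_0_iff)
    then show ?thesis by (simp add: a_def)
  qed
  then show ?thesis by blast
qed

lemma inner_eqI: "(\<And>z. x \<bullet> z = y \<bullet> z) \<Longrightarrow> x = (y::'a::real_inner)"
  by (metis all_zero_iff eq_iff_diff_eq_0 inner_diff_left)

text \<open>For fixed y, Riesz represents the functional taking x to \<open>T x \<bullet> y\<close>.
  Only the real inner product occurs here; complex linearity of the adjoint is recovered
  separately.\<close>

lemma adjoint_exists:
  fixes T :: "'a::{real_inner, complete_space} \<Rightarrow>\<^sub>L 'a"
  shows "\<exists>S :: 'a \<Rightarrow>\<^sub>L 'a. \<forall>x y. T x \<bullet> y = x \<bullet> S y"
proof -
  have "\<exists>z. \<forall>x. T x \<bullet> y = z \<bullet> x" for y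
    by (rule riesz_representation) (intro bounded_linear_intros)
  then obtain S where S: "\<And>x y. T x \<bullet> y = S y \<bullet> x" by metis
  have "bounded_linear S"
  proof (rule bounded_linear_intro[where K = "norm T"])
    show "S (x + y) = S x + S y" for x y
      by (rule inner_eqI) (simp add: S[symmetric] inner_add)
    show "S (r *\<^sub>R x) = r *\<^sub>R S x" for r x
      by (rule inner_eqI) (simp add: S[symmetric])
    fix y
    have "norm (S y) * norm (S y) = S y \<bullet> S y"
      by (simp add: power2_norm_eq_inner[symmetric] power2_eq_square)
    also have "\<dots> = T (S y) \<bullet> y" by (rule S[symmetric])
    also have "\<dots> \<le> norm (T (S y)) * norm y" by (rule norm_cauchy_schwarz)
    also have "\<dots> \<le> norm T * norm (S y) * norm y"
      by (intro mult_right_mono norm_blinfun) auto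
    finally have "norm (S y) * norm (S y) \<le> norm (S y) * (norm y * norm T)"
      by (simp add: ac_simps)
    then show "norm (S y) \<le> norm y * norm T"
      by (cases "norm (S y) = 0") (auto simp: mult_le_cancel_left)
  qed
  then have "blinfun_apply (Blinfun S) = S" by (rule bounded_linear_Blinfun_apply)
  with S show ?thesis by (metis inner_commute)
qed

definition blinfun_adjoint :: "('a::{real_inner, complete_space} \<Rightarrow>\<^sub>L 'a) \<Rightarrow> ('a \<Rightarrow>\<^sub>L 'a)" where
  "blinfun_adjoint T = (SOME S. \<forall>x y. T x \<bullet> y = x \<bullet> blinfun_apply S y)"

lemma inner_blinfun_adjoint_right: "x \<bullet> blinfun_adjoint T y = T x \<bullet> y"
  using someI_ex[OF adjoint_exists, of T, THEN spec, THEN spec, symmetric]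
  unfolding blinfun_adjoint_def .

lemma inner_blinfun_adjoint_left: "blinfun_adjoint T x \<bullet> y = x \<bullet> T y"
  using inner_blinfun_adjoint_right[of y T x] by (simp only: inner_commute)

lemma blinfun_adjoint_unique:
  "(\<And>x y. blinfun_apply T x \<bullet> y = x \<bullet> blinfun_apply S y) \<Longrightarrow> blinfun_adjoint T = S"
proof (rule blinfun_eqI, rule inner_eqI)
  fix y z assume "\<And>x y. T x \<bullet> y = x \<bullet> blinfun_apply S y"
  then have "z \<bullet> blinfun_adjoint T y = z \<bullet> S y" by (simp only: inner_blinfun_adjoint_right)
  then show "blinfun_adjoint T y \<bullet> z = S y \<bullet> z" by (simp only: inner_commute)
qed

lemma blinfun_adjoint_adjoint [simp]: "blinfun_adjoint (blinfun_adjoint T) = T"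
  by (rule blinfun_adjoint_unique) (rule inner_blinfun_adjoint_left)

lemma blinfun_adjoint_add: "blinfun_adjoint (S + T) = blinfun_adjoint S + blinfun_adjoint T"
  by (rule blinfun_adjoint_unique)
    (simp add: blinfun.add_left inner_add inner_blinfun_adjoint_right)

lemma blinfun_adjoint_compose:
  "blinfun_adjoint (S o\<^sub>L T) = blinfun_adjoint T o\<^sub>L blinfun_adjoint S"
  by (rule blinfun_adjoint_unique) (simp add: inner_blinfun_adjoint_right)

lemma norm_blinfun_adjoint_le: "norm (blinfun_adjoint T) \<le> norm T"
proof (rule norm_blinfun_bound)
  fix y
  let ?z = "blinfun_adjoint T y"
  have "norm ?z * norm ?z = ?z \<bullet> ?z"
    by (simp add: power2_norm_eq_inner[symmetric] power2_eq_square)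
  also have "\<dots> = T ?z \<bullet> y" by (rule inner_blinfun_adjoint_right)
  also have "\<dots> \<le> norm (T ?z) * norm y" by (rule norm_cauchy_schwarz)
  also have "\<dots> \<le> norm T * norm ?z * norm y"
    by (intro mult_right_mono norm_blinfun) auto
  finally have "norm ?z * norm ?z \<le> norm ?z * (norm T * norm y)"
    by (simp add: ac_simps)
  then show "norm ?z \<le> norm T * norm y"
    by (cases "norm ?z = 0") (auto simp: mult_le_cancel_left)
qed simp

text \<open>This becomes the C*-identity. The nontrivial bound comes from Cauchy-Schwarz, since the
  squared norm of T x is the inner product of T*T x with x.\<close>

lemma norm_blinfun_adjoint_compose_self: "norm (blinfun_adjoint T o\<^sub>L T) = (norm T)\<^sup>2"
proof (rule antisym)
  have "norm (blinfun_adjoint T o\<^sub>L T) \<le> norm (blinfun_adjoint T) * norm T"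
    by (rule norm_blinfun_compose)
  also have "\<dots> \<le> norm T * norm T"
    by (rule mult_right_mono[OF norm_blinfun_adjoint_le]) simp
  finally show "norm (blinfun_adjoint T o\<^sub>L T) \<le> (norm T)\<^sup>2" by (simp add: power2_eq_square)
next
  let ?c = "norm (blinfun_adjoint T o\<^sub>L T)"
  have "norm T \<le> sqrt ?c"
  proof (rule norm_blinfun_bound)
    fix x
    have "(norm (T x))\<^sup>2 = (blinfun_adjoint T o\<^sub>L T) x \<bullet> x"
      by (simp add: power2_norm_eq_inner inner_blinfun_adjoint_left)
    also have "\<dots> \<le> norm ((blinfun_adjoint T o\<^sub>L T) x) * norm x" by (rule norm_cauchy_schwarz)
    also have "\<dots> \<le> ?c * norm x * norm x" by (intro mult_right_mono norm_blinfun) auto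
    also have "\<dots> = (sqrt ?c * norm x)\<^sup>2" by (simp add: power_mult_distrib power2_eq_square)
    finally show "norm (T x) \<le> sqrt ?c * norm x" by (rule power2_le_imp_le) simp
  qed simp
  then have "(norm T)\<^sup>2 \<le> (sqrt ?c)\<^sup>2" by (rule power_mono) simp
  then show "(norm T)\<^sup>2 \<le> ?c" by simp
qed


section \<open>The Hilbert space of square-summable sequences\<close>

text \<open>The model Hilbert space. It is made an instance of \<open>real_inner\<close>, with the
  real part of the usual inner product, so that bounded linear maps and the adjoints above apply;
  complex scalars enter afterwards as operators.\<close>

typedef ell2 = "{x :: nat \<Rightarrow> complex. summable (\<lambda>n. (cmod (x n))\<^sup>2)}"
  morphisms coord Abs_ell2
  by (rule exI[of _ "\<lambda>_. 0"]) simp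

setup_lifting type_definition_ell2

lemma summable_coord [simp]: "summable (\<lambda>n. (cmod (coord x n))\<^sup>2)"
  using coord[of x] by simp

lemma coord_Abs_ell2: "summable (\<lambda>n. (cmod (x n))\<^sup>2) \<Longrightarrow> coord (Abs_ell2 x) = x"
  by (simp add: Abs_ell2_inverse)

lemma ell2_eqI: "(\<And>n. coord x n = coord y n) \<Longrightarrow> x = y"
  by (metis coord_inject ext)

lemma summable_cmod_power2_add:
  assumes "summable (\<lambda>n. (cmod (x n))\<^sup>2)" "summable (\<lambda>n. (cmod (y n))\<^sup>2)"
  shows "summable (\<lambda>n. (cmod (x n + y n))\<^sup>2)"
proof (rule summable_comparison_test')
  show "summable (\<lambda>n. 2 * (cmod (x n))\<^sup>2 + 2 * (cmod (y n))\<^sup>2)"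
    by (intro summable_add summable_mult assms)
  fix n
  have "(cmod (x n + y n))\<^sup>2 \<le> (cmod (x n) + cmod (y n))\<^sup>2"
    by (intro power_mono norm_triangle_ineq) simp
  also have "\<dots> \<le> 2 * (cmod (x n))\<^sup>2 + 2 * (cmod (y n))\<^sup>2"
    using sum_squares_bound[of "cmod (x n)" "cmod (y n)"] by (simp add: power2_sum)
  finally show "norm ((cmod (x n + y n))\<^sup>2) \<le> 2 * (cmod (x n))\<^sup>2 + 2 * (cmod (y n))\<^sup>2" by simp
qed

lemma summable_cmod_power2_scale:
  "summable (\<lambda>n. (cmod (x n))\<^sup>2) \<Longrightarrow> summable (\<lambda>n. (cmod (c * x n))\<^sup>2)"
  by (simp add: norm_mult power_mult_distrib summable_mult)

lemma summable_norm_coord_mult: "summable (\<lambda>n. cmod (coord x n) * cmod (coord y n))"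
proof (rule summable_comparison_test')
  show "summable (\<lambda>n. (cmod (coord x n))\<^sup>2 + (cmod (coord y n))\<^sup>2)"
    by (intro summable_add summable_coord)
  fix n
  have "2 * (cmod (coord x n) * cmod (coord y n)) \<le> (cmod (coord x n))\<^sup>2 + (cmod (coord y n))\<^sup>2"
    using sum_squares_bound[of "cmod (coord x n)" "cmod (coord y n)"] by (simp add: mult.assoc)
  moreover have "0 \<le> cmod (coord x n) * cmod (coord y n)" by simp
  ultimately show "norm (cmod (coord x n) * cmod (coord y n)) \<le>
      (cmod (coord x n))\<^sup>2 + (cmod (coord y n))\<^sup>2"
    by (subst real_norm_def, subst abs_of_nonneg) linarith+
qed

lemma summable_coord_mult: "summable (\<lambda>n. coord x n * cnj (coord y n))"
  by (rule summable_comparison_test'[OF summable_norm_coord_mult[of x y]]) (simp add: norm_mult)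

lemma summable_coord_inner: "summable (\<lambda>n. coord x n \<bullet> coord y n)"
  by (rule summable_comparison_test'[OF summable_norm_coord_mult[of x y]])
    (simp add: Cauchy_Schwarz_ineq2)

instantiation ell2 :: real_inner
begin

lift_definition zero_ell2 :: ell2 is "\<lambda>_. 0" by simp

lift_definition plus_ell2 :: "ell2 \<Rightarrow> ell2 \<Rightarrow> ell2" is "\<lambda>x y n. x n + y n"
  by (rule summable_cmod_power2_add)

lift_definition uminus_ell2 :: "ell2 \<Rightarrow> ell2" is "\<lambda>x n. - x n" by simp

lift_definition minus_ell2 :: "ell2 \<Rightarrow> ell2 \<Rightarrow> ell2" is "\<lambda>x y n. x n - y n"
  using summable_cmod_power2_add[of _ "\<lambda>n. - _ n"] by simp

lift_definition scaleR_ell2 :: "real \<Rightarrow> ell2 \<Rightarrow> ell2" is "\<lambda>r x n. r *\<^sub>R x n"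
  by (simp add: power_mult_distrib summable_mult)

definition inner_ell2 :: "ell2 \<Rightarrow> ell2 \<Rightarrow> real" where
  "inner_ell2 x y = (\<Sum>n. coord x n \<bullet> coord y n)"

definition norm_ell2 :: "ell2 \<Rightarrow> real" where "norm_ell2 x = sqrt (x \<bullet> x)"

definition dist_ell2 :: "ell2 \<Rightarrow> ell2 \<Rightarrow> real" where "dist_ell2 x y = norm (x - y)"

definition sgn_ell2 :: "ell2 \<Rightarrow> ell2" where "sgn_ell2 x = scaleR (inverse (norm x)) x"

definition [code del]:
  "(uniformity :: (ell2 \<times> ell2) filter) = (INF e\<in>{0 <..}. principal {(x, y). dist x y < e})"

definition open_ell2 :: "ell2 set \<Rightarrow> bool" where
  [code del]: "open_ell2 S = (\<forall>x\<in>S. \<forall>\<^sub>F (x', y) in uniformity. x' = x \<longrightarrow> y \<in> S)"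

instance
proof
  fix x y z :: ell2 and r q :: real and U :: "ell2 set"
  show "x + y + z = x + (y + z)" "x + y = y + x" "0 + x = x" "- x + x = 0" "x - y = x + - y"
    by (transfer; simp add: algebra_simps)+
  show "r *\<^sub>R (x + y) = r *\<^sub>R x + r *\<^sub>R y" "(r + q) *\<^sub>R x = r *\<^sub>R x + q *\<^sub>R x"
    "r *\<^sub>R q *\<^sub>R x = (r * q) *\<^sub>R x" "1 *\<^sub>R x = x"
    by (transfer; simp add: algebra_simps)+
  show "dist x y = norm (x - y)" "sgn x = scaleR (inverse (norm x)) x" "norm x = sqrt (x \<bullet> x)"
    by (simp_all add: dist_ell2_def sgn_ell2_def norm_ell2_def)
  show "x \<bullet> y = y \<bullet> x" by (simp add: inner_ell2_def inner_commute)
  show "(x + y) \<bullet> z = x \<bullet> z + y \<bullet> z"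
    unfolding inner_ell2_def
    by (subst suminf_add[OF summable_coord_inner summable_coord_inner])
      (simp add: plus_ell2.rep_eq inner_add)
  show "(r *\<^sub>R x) \<bullet> y = r * (x \<bullet> y)"
    unfolding inner_ell2_def
    by (subst suminf_mult[OF summable_coord_inner, symmetric])
      (simp add: scaleR_ell2.rep_eq del: scaleR_conv_of_real)
  show "0 \<le> x \<bullet> x"
    unfolding inner_ell2_def by (intro suminf_nonneg summable_coord_inner) simp
  show "x \<bullet> x = 0 \<longleftrightarrow> x = 0"
    unfolding inner_ell2_def
    by (subst suminf_eq_zero_iff[OF summable_coord_inner])
      (auto simp: zero_ell2.rep_eq intro!: ell2_eqI)
qed (simp_all add: uniformity_ell2_def open_ell2_def)

end

lemma norm_ell2_power2: "(norm x)\<^sup>2 = (\<Sum>n. (cmod (coord x n))\<^sup>2)"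
  by (simp add: power2_norm_eq_inner inner_ell2_def)

lemma sum_coord_le_norm: "(\<Sum>n<m. (cmod (coord x n))\<^sup>2) \<le> (norm x)\<^sup>2"
  unfolding norm_ell2_power2 by (rule sum_le_suminf) auto

lemma cmod_coord_le_norm: "cmod (coord x n) \<le> norm x"
proof (rule power2_le_imp_le)
  have "(cmod (coord x n))\<^sup>2 \<le> (\<Sum>k<Suc n. (cmod (coord x k))\<^sup>2)"
    by (rule member_le_sum) auto
  then show "(cmod (coord x n))\<^sup>2 \<le> (norm x)\<^sup>2" using sum_coord_le_norm order_trans by blast
qed simp

instance ell2 :: complete_space
proof
  fix X :: "nat \<Rightarrow> ell2"
  assume X: "Cauchy X"
  have "Cauchy (\<lambda>k. coord (X k) n)" for n
  proof (rule metric_CauchyI)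
    fix e :: real assume "0 < e"
    then obtain N where N: "\<forall>i\<ge>N. \<forall>j\<ge>N. dist (X i) (X j) < e" using metric_CauchyD[OF X] by blast
    have "dist (coord (X i) n) (coord (X j) n) \<le> dist (X i) (X j)" for i j
      using cmod_coord_le_norm[of "X i - X j" n] by (simp add: dist_norm minus_ell2.rep_eq)
    with N show "\<exists>M. \<forall>i\<ge>M. \<forall>j\<ge>M. dist (coord (X i) n) (coord (X j) n) < e"
      using le_less_trans by blast
  qed
  then have "\<exists>l. (\<lambda>k. coord (X k) n) \<longlonglongrightarrow> l" for n
    by (simp add: Cauchy_convergent_iff convergent_def)
  then obtain L where L: "\<And>n. (\<lambda>k. coord (X k) n) \<longlonglongrightarrow> L n" by metis
  \<comment> \<open>Finite sums are bounded uniformly in m because a finite sum passes to the limit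
    in j coordinate by coordinate, which is not clear for the full norm.\<close>
  have bound: "\<exists>N. \<forall>i\<ge>N. \<forall>m. (\<Sum>n<m. (cmod (coord (X i) n - L n))\<^sup>2) \<le> e\<^sup>2" if "0 < e" for e :: real
  proof -
    obtain N where N: "\<forall>i\<ge>N. \<forall>j\<ge>N. dist (X i) (X j) < e" using metric_CauchyD[OF X \<open>0 < e\<close>] by blast
    show ?thesis
    proof (intro exI[of _ N] allI impI)
      fix i m assume i: "N \<le> i"
      have lim: "(\<lambda>j. \<Sum>n<m. (cmod (coord (X i) n - coord (X j) n))\<^sup>2) \<longlonglongrightarrow>
          (\<Sum>n<m. (cmod (coord (X i) n - L n))\<^sup>2)"
        by (intro tendsto_intros L)
      have "(\<Sum>n<m. (cmod (coord (X i) n - coord (X j) n))\<^sup>2) \<le> e\<^sup>2" if "N \<le> j" for j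
      proof -
        have "(\<Sum>n<m. (cmod (coord (X i) n - coord (X j) n))\<^sup>2) \<le> (norm (X i - X j))\<^sup>2"
          using sum_coord_le_norm[of "X i - X j" m] by (simp add: minus_ell2.rep_eq)
        also have "\<dots> \<le> e\<^sup>2"
          using N i that by (intro power_mono) (auto simp: dist_norm less_imp_le)
        finally show ?thesis .
      qed
      then show "(\<Sum>n<m. (cmod (coord (X i) n - L n))\<^sup>2) \<le> e\<^sup>2"
        by (intro LIMSEQ_le_const2[OF lim]) blast
    qed
  qed
  have diff: "summable (\<lambda>n. (cmod (coord (X i) n - L n))\<^sup>2)"
    if "\<forall>m. (\<Sum>n<m. (cmod (coord (X i) n - L n))\<^sup>2) \<le> c" for i c
    by (rule bounded_imp_summable[where B = c])
      (use that in \<open>auto simp: lessThan_Suc_atMost[symmetric] simp del: sum.lessThan_Suc\<close>)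
  obtain N where "\<forall>m. (\<Sum>n<m. (cmod (coord (X N) n - L n))\<^sup>2) \<le> 1\<^sup>2"
    using bound[of 1] by auto
  \<comment> \<open>The coordinatewise limit L is square-summable, being the difference of
    \<open>X N\<close> and the sequence \<open>X N - L\<close>.\<close>
  then have "summable (\<lambda>n. (cmod (coord (X N) n - (coord (X N) n - L n)))\<^sup>2)"
    using summable_cmod_power2_add[OF summable_coord[of "X N"], of "\<lambda>n. - (coord (X N) n - L n)"]
      diff[of N] by (simp add: norm_minus_commute)
  then have coord_L: "coord (Abs_ell2 L) = L" by (intro coord_Abs_ell2) simp
  have "X \<longlonglongrightarrow> Abs_ell2 L"
  proof (rule metric_LIMSEQ_I)
    fix e :: real assume e: "0 < e"
    then obtain N where N: "\<forall>i\<ge>N. \<forall>m. (\<Sum>n<m. (cmod (coord (X i) n - L n))\<^sup>2) \<le> (e/2)\<^sup>2"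
      using bound[of "e/2"] by auto
    show "\<exists>N. \<forall>i\<ge>N. dist (X i) (Abs_ell2 L) < e"
    proof (intro exI[of _ N] allI impI)
      fix i assume i: "N \<le> i"
      have "(norm (X i - Abs_ell2 L))\<^sup>2 = (\<Sum>n. (cmod (coord (X i) n - L n))\<^sup>2)"
        by (simp add: norm_ell2_power2 minus_ell2.rep_eq coord_L)
      also have "\<dots> \<le> (e/2)\<^sup>2"
        using N i by (intro suminf_le_const diff[of i "(e/2)\<^sup>2"]) auto
      finally have "norm (X i - Abs_ell2 L) \<le> e/2" using e by (auto intro: power2_le_imp_le)
      then show "dist (X i) (Abs_ell2 L) < e" using e by (simp add: dist_norm)
    qed
  qed
  then show "convergent X" by (rule convergentI)
qed

instance ell2 :: banach ..

section \<open>Complex-linear operators\<close>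

lift_definition cscale :: "complex \<Rightarrow> ell2 \<Rightarrow> ell2" (infixr \<open>*\<^sub>C\<close> 75) is "\<lambda>c x n. c * x n"
  by (rule summable_cmod_power2_scale)

lemma cscale_simps:
  "c *\<^sub>C (x + y) = c *\<^sub>C x + c *\<^sub>C y" "(c + d) *\<^sub>C x = c *\<^sub>C x + d *\<^sub>C x"
  "c *\<^sub>C d *\<^sub>C x = (c * d) *\<^sub>C x" "1 *\<^sub>C x = x" "c *\<^sub>C r *\<^sub>R x = r *\<^sub>R c *\<^sub>C x"
  by (transfer; simp add: algebra_simps)+

lemma inner_cscale_left: "(c *\<^sub>C x) \<bullet> y = x \<bullet> (cnj c *\<^sub>C y)"
  unfolding inner_ell2_def
  by (simp add: cscale.rep_eq inner_complex_def algebra_simps)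

lemma norm_cscale [simp]: "norm (c *\<^sub>C x) = cmod c * norm x"
proof -
  have "(norm (c *\<^sub>C x))\<^sup>2 = (cmod c * norm x)\<^sup>2"
    by (simp add: norm_ell2_power2 cscale.rep_eq norm_mult power_mult_distrib suminf_mult)
  then show ?thesis by simp
qed

lift_definition cscale_blinfun :: "complex \<Rightarrow> ell2 \<Rightarrow>\<^sub>L ell2" is cscale
  subgoal for c by (rule bounded_linear_intro[where K = "cmod c"]) (simp_all add: cscale_simps)
  done

lemma bounded_linear_cscale: "bounded_linear (cscale c)"
  using blinfun.bounded_linear_right[of "cscale_blinfun c"] by (simp add: cscale_blinfun.rep_eq)

definition cinner :: "ell2 \<Rightarrow> ell2 \<Rightarrow> complex" where
  "cinner x y = (\<Sum>n. coord x n * cnj (coord y n))"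

lemma Re_cinner: "Re (cinner x y) = x \<bullet> y"
  unfolding cinner_def inner_ell2_def
  by (subst bounded_linear.suminf[OF bounded_linear_Re summable_coord_mult])
    (simp add: inner_complex_def)

text \<open>The imaginary part of w is the real part of -\<i> w, and conjugation turns \<i> in the
  second argument into -\<i>. Thus the complex inner product is determined by the real one, and
  adjoint identities carry over for complex-linear operators.\<close>

lemma Im_cinner: "Im (cinner x y) = x \<bullet> (\<i> *\<^sub>C y)"
  unfolding cinner_def inner_ell2_def
  by (subst bounded_linear.suminf[OF bounded_linear_Im summable_coord_mult])
    (simp add: inner_complex_def cscale.rep_eq)

definition scale_op :: "complex \<Rightarrow> (ell2 \<Rightarrow>\<^sub>L ell2) \<Rightarrow> (ell2 \<Rightarrow>\<^sub>L ell2)" where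
  "scale_op c T = cscale_blinfun c o\<^sub>L T"

lemma scale_op_apply [simp]: "scale_op c T x = c *\<^sub>C T x"
  by (simp add: scale_op_def cscale_blinfun.rep_eq)

lemma norm_scale_op: "norm (scale_op c T) = cmod c * norm T"
proof (rule antisym)
  show "norm (scale_op c T) \<le> cmod c * norm T"
    by (rule norm_blinfun_bound) (auto simp: mult.assoc intro!: mult_left_mono norm_blinfun)
  show "cmod c * norm T \<le> norm (scale_op c T)"
  proof (cases "c = 0")
    case False
    have "norm T \<le> norm (scale_op c T) / cmod c"
    proof (rule norm_blinfun_bound)
      fix x
      have "cmod c * norm (T x) \<le> norm (scale_op c T) * norm x"
        using norm_blinfun[of "scale_op c T" x] by simp
      then show "norm (T x) \<le> norm (scale_op c T) / cmod c * norm x"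
        using False by (simp add: field_simps)
    qed simp
    then show ?thesis using False by (simp add: field_simps)
  qed simp
qed

text \<open>A \<open>blinfun\<close> on \<open>ell2\<close> is merely real-linear, whereas
  \<open>bounded_ops\<close> consists of complex-linear maps; this set singles out their
  counterparts.\<close>

definition clinear_ops :: "(ell2 \<Rightarrow>\<^sub>L ell2) set" where
  "clinear_ops = {T. \<forall>c x. blinfun_apply T (c *\<^sub>C x) = c *\<^sub>C blinfun_apply T x}"

lemma clinear_opsD: "T \<in> clinear_ops \<Longrightarrow> blinfun_apply T (c *\<^sub>C x) = c *\<^sub>C T x"
  by (simp add: clinear_ops_def)

lemma cscale_minus_right: "c *\<^sub>C (- x) = - (c *\<^sub>C x)" by (transfer; simp)

lemma clinear_ops_closed:
  "0 \<in> clinear_ops"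
  "S \<in> clinear_ops \<Longrightarrow> T \<in> clinear_ops \<Longrightarrow> S + T \<in> clinear_ops"
  "T \<in> clinear_ops \<Longrightarrow> - T \<in> clinear_ops"
  "S \<in> clinear_ops \<Longrightarrow> T \<in> clinear_ops \<Longrightarrow> S o\<^sub>L T \<in> clinear_ops"
  "T \<in> clinear_ops \<Longrightarrow> scale_op c T \<in> clinear_ops"
  using bounded_linear.linear[OF bounded_linear_cscale, THEN linear_0]
  by (auto simp: clinear_ops_def blinfun.bilinear_simps cscale_simps cscale_minus_right mult.commute)

text \<open>Multiplication by c has adjoint multiplication by \<open>cnj c\<close>, so commuting
  with all scalars is inherited by the adjoint.\<close>

lemma clinear_ops_adjoint:
  assumes "T \<in> clinear_ops"
  shows "blinfun_adjoint T \<in> clinear_ops"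
  unfolding clinear_ops_def
proof (safe, rule inner_eqI)
  fix c y x
  have "x \<bullet> blinfun_adjoint T (c *\<^sub>C y) = T (cnj c *\<^sub>C x) \<bullet> y"
    by (simp add: inner_blinfun_adjoint_right clinear_opsD[OF assms] inner_cscale_left)
  also have "\<dots> = x \<bullet> c *\<^sub>C blinfun_adjoint T y"
    by (simp add: inner_blinfun_adjoint_right[symmetric] inner_cscale_left)
  finally show "blinfun_adjoint T (c *\<^sub>C y) \<bullet> x = (c *\<^sub>C blinfun_adjoint T y) \<bullet> x"
    by (simp only: inner_commute)
qed

lemma blinfun_adjoint_scale_op:
  assumes "T \<in> clinear_ops"
  shows "blinfun_adjoint (scale_op c T) = scale_op (cnj c) (blinfun_adjoint T)"
  by (rule blinfun_adjoint_unique)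
    (simp add: inner_cscale_left clinear_opsD[OF clinear_ops_adjoint[OF assms], symmetric]
      inner_blinfun_adjoint_right)

lemma cinner_blinfun_adjoint:
  assumes "T \<in> clinear_ops"
  shows "cinner (T x) y = cinner x (blinfun_adjoint T y)"
  by (rule complex_eqI)
    (simp_all add: Re_cinner Im_cinner inner_blinfun_adjoint_right
      clinear_opsD[OF clinear_ops_adjoint[OF assms], symmetric])

lemma cinner_adjoint_unique:
  assumes "\<And>x y. cinner (blinfun_apply T x) y = cinner x (blinfun_apply S y)"
  shows "S = blinfun_adjoint T"
proof (rule blinfun_adjoint_unique[symmetric])
  show "T x \<bullet> y = x \<bullet> S y" for x y using arg_cong[OF assms[of x y], of Re] by (simp add: Re_cinner)
qed

text \<open>Complex linearity is a closed condition; this yields completeness of the operator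
  algebra from that of the Banach space of all \<open>blinfun\<close>s.\<close>

lemma clinear_ops_limit:
  assumes "\<And>n. X n \<in> clinear_ops" "X \<longlonglongrightarrow> T"
  shows "T \<in> clinear_ops"
  unfolding clinear_ops_def
proof safe
  fix c x
  have lim: "(\<lambda>n. X n z) \<longlonglongrightarrow> T z" for z by (intro tendsto_intros assms)
  have "(\<lambda>n. c *\<^sub>C X n x) \<longlonglongrightarrow> c *\<^sub>C T x"
    by (rule bounded_linear.tendsto[OF bounded_linear_cscale lim])
  then show "T (c *\<^sub>C x) = c *\<^sub>C T x"
    using lim[of "c *\<^sub>C x"] LIMSEQ_unique by (simp add: clinear_opsD[OF assms(1)])
qed

section \<open>Counting measure on the natural numbers as a real measure\<close>

abbreviation nat_count :: "real measure" where
  "nat_count \<equiv> count_space (range real)"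

lemma sigma_finite_nat_count: "sigma_finite_measure nat_count"
  by (rule sigma_finite_measure_count_space_countable) simp

lemma bij_betw_real: "bij_betw real UNIV (range real)"
  by (simp add: bij_betw_def inj_on_def)

lemma integral_nat_count:
  fixes f :: "real \<Rightarrow> 'b::{banach, second_countable_topology}"
  assumes "summable (\<lambda>n. norm (f (real n)))"
  shows "integral\<^sup>L nat_count f = (\<Sum>n. f (real n))"
  using integral_bij_count_space[OF bij_betw_real, of f]
    integral_count_space_nat[of "\<lambda>n. f (real n)"] assms
  by (simp add: integrable_count_space_nat_iff)

lemma L2_fun_iff: "\<phi> \<in> L2_fun nat_count \<longleftrightarrow> summable (\<lambda>n. (cmod (\<phi> (real n)))\<^sup>2)"
  using integrable_bij_count_space[OF bij_betw_real, of "\<lambda>x. (cmod (\<phi> x))\<^sup>2"]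
  by (simp add: L2_fun_def integrable_count_space_nat_iff)

lemma L2_rel_iff:
  "(\<phi>, \<psi>) \<in> L2_rel nat_count \<longleftrightarrow>
    \<phi> \<in> L2_fun nat_count \<and> \<psi> \<in> L2_fun nat_count \<and> (\<forall>n. \<phi> (real n) = \<psi> (real n))"
  by (auto simp: L2_rel_def AE_count_space)

lemma equiv_L2_rel: "equiv (L2_fun nat_count) (L2_rel nat_count)"
  by (rule equivI) (auto simp: L2_rel_iff intro!: refl_onI symI transI)

lemma L2_class_in_L2 [simp]: "\<phi> \<in> L2_fun nat_count \<Longrightarrow> L2_class nat_count \<phi> \<in> L2 nat_count"
  unfolding L2_class_def L2_def by (rule quotientI)

lemma L2_class_eq_iff:
  assumes "\<phi> \<in> L2_fun nat_count" "\<psi> \<in> L2_fun nat_count"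
  shows "L2_class nat_count \<phi> = L2_class nat_count \<psi> \<longleftrightarrow> (\<forall>n. \<phi> (real n) = \<psi> (real n))"
  unfolding L2_class_def using assms eq_equiv_class_iff[OF equiv_L2_rel assms] L2_rel_iff by auto

text \<open>The choice made by \<open>L2_rep\<close> is harmless: members of one class agree almost
  everywhere, which for \<open>nat_count\<close> means at every point of
  \<open>range real\<close>.\<close>

lemma L2_rep_L2_class:
  assumes "\<phi> \<in> L2_fun nat_count"
  shows "L2_rep (L2_class nat_count \<phi>) (real n) = \<phi> (real n)"
proof -
  have "\<phi> \<in> L2_class nat_count \<phi>"
    unfolding L2_class_def by (rule equiv_class_self[OF equiv_L2_rel assms])
  then have "L2_rep (L2_class nat_count \<phi>) \<in> L2_class nat_count \<phi>"
    unfolding L2_rep_def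
    by (rule someI[where P = "\<lambda>\<psi>. \<psi> \<in> L2_class nat_count \<phi>"])
  then show ?thesis by (simp add: L2_class_def L2_rel_iff)
qed

text \<open>The term \<open>nat \<lfloor>r\<rfloor>\<close> recovers n from \<open>real n\<close>;
  values at other reals lie outside the space and do not affect the class.\<close>

definition of_ell2 :: "ell2 \<Rightarrow> (real \<Rightarrow> complex) set" where
  "of_ell2 x = L2_class nat_count (\<lambda>r. coord x (nat \<lfloor>r\<rfloor>))"

definition to_ell2 :: "(real \<Rightarrow> complex) set \<Rightarrow> ell2" where
  "to_ell2 U = Abs_ell2 (\<lambda>n. L2_rep U (real n))"

lemma of_ell2_rep_in_L2_fun [simp]: "(\<lambda>r. coord x (nat \<lfloor>r\<rfloor>)) \<in> L2_fun nat_count"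
  by (simp add: L2_fun_iff)

lemma L2_class_eq_of_ell2:
  assumes "summable (\<lambda>n. (cmod (\<phi> (real n)))\<^sup>2)"
  shows "L2_class nat_count \<phi> = of_ell2 (Abs_ell2 (\<lambda>n. \<phi> (real n)))"
  unfolding of_ell2_def using assms
  by (subst L2_class_eq_iff) (auto simp: L2_fun_iff coord_Abs_ell2)

lemma L2_rep_of_ell2 [simp]: "L2_rep (of_ell2 x) (real n) = coord x n"
  unfolding of_ell2_def by (subst L2_rep_L2_class) auto

lemma to_of_ell2 [simp]: "to_ell2 (of_ell2 x) = x"
  by (simp add: to_ell2_def coord_inverse)

lemma of_ell2_inject [simp]: "of_ell2 x = of_ell2 y \<longleftrightarrow> x = y"
  using to_of_ell2 by metis

lemma L2_nat_count: "L2 nat_count = range of_ell2"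
proof safe
  fix U assume "U \<in> L2 nat_count"
  then obtain \<phi> where "\<phi> \<in> L2_fun nat_count" "U = L2_class nat_count \<phi>"
    unfolding L2_def L2_class_def by (rule quotientE)
  then show "U \<in> range of_ell2" using L2_class_eq_of_ell2 by (auto simp: L2_fun_iff)
next
  show "of_ell2 x \<in> L2 nat_count" for x unfolding of_ell2_def by simp
qed

lemma of_ell2_in_L2 [simp]: "of_ell2 x \<in> L2 nat_count" by (simp add: L2_nat_count)

lemma L2_class_coord:
  "(\<And>n. \<phi> (real n) = coord x n) \<Longrightarrow> L2_class nat_count \<phi> = of_ell2 x"
  by (simp add: L2_class_eq_of_ell2 coord_inverse)

lemma L2_class_coordE:
  assumes "\<phi> \<in> L2_fun nat_count"
  obtains x where "\<And>n. coord x n = \<phi> (real n)" "L2_class nat_count \<phi> = of_ell2 x"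
  using assms L2_class_eq_of_ell2[of \<phi>] coord_Abs_ell2[of "\<lambda>n. \<phi> (real n)"]
  unfolding L2_fun_iff by metis

lemma L2_add_of_ell2 [simp]: "L2_add nat_count (of_ell2 x) (of_ell2 y) = of_ell2 (x + y)"
  unfolding L2_add_def by (rule L2_class_coord) (simp add: plus_ell2.rep_eq)

lemma L2_scale_of_ell2 [simp]: "L2_scale nat_count c (of_ell2 x) = of_ell2 (c *\<^sub>C x)"
  unfolding L2_scale_def by (rule L2_class_coord) (simp add: cscale.rep_eq)

lemma L2_zero: "L2_class nat_count (\<lambda>_. 0) = of_ell2 0"
  by (rule L2_class_coord) (simp add: zero_ell2.rep_eq)

lemma L2_inner_of_ell2 [simp]: "L2_inner nat_count (of_ell2 x) (of_ell2 y) = cinner x y"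
  unfolding L2_inner_def cinner_def
  by (subst integral_nat_count) (simp_all add: norm_mult summable_norm_coord_mult)

lemma L2_norm_of_ell2 [simp]: "L2_norm nat_count (of_ell2 x) = norm x"
  unfolding L2_norm_def by (subst integral_nat_count) (simp_all add: norm_ell2_power2[symmetric])

definition op_of :: "(ell2 \<Rightarrow>\<^sub>L ell2) \<Rightarrow> real L2_op" where
  "op_of T = (\<lambda>U\<in>L2 nat_count. of_ell2 (T (to_ell2 U)))"

lemma op_of_apply [simp]: "op_of T (of_ell2 x) = of_ell2 (T x)"
  by (simp add: op_of_def)

lemma op_of_inject [simp]: "op_of S = op_of T \<longleftrightarrow> S = T"
proof
  assume "op_of S = op_of T"
  then have "of_ell2 (S x) = of_ell2 (T x)" for x using op_of_apply[of S x] by simp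
  then show "S = T" by (intro blinfun_eqI) simp
qed simp

lemma restrict_eq_op_of:
  "(\<And>x. F (of_ell2 x) = of_ell2 (blinfun_apply T x)) \<Longrightarrow> (\<lambda>U\<in>L2 nat_count. F U) = op_of T"
  unfolding op_of_def by (rule restrict_ext) (auto simp: L2_nat_count)

text \<open>Every class has the form \<open>of_ell2 x\<close>, so an extensional operator on classes
  is determined by a map on sequences. Its real linearity is the case of real scalars in complex
  homogeneity.\<close>

lemma bounded_ops_nat_count: "bounded_ops nat_count = op_of ` clinear_ops"
proof safe
  fix F assume "F \<in> bounded_ops nat_count"
  then have F_ops: "F \<in> L2 nat_count \<rightarrow>\<^sub>E L2 nat_count"
    "\<forall>U\<in>range of_ell2. \<forall>V\<in>range of_ell2. F (L2_add nat_count U V) = L2_add nat_count (F U) (F V)"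
    "\<forall>U\<in>range of_ell2. \<forall>c. F (L2_scale nat_count c U) = L2_scale nat_count c (F U)"
    "\<exists>C. \<forall>U\<in>range of_ell2. L2_norm nat_count (F U) \<le> C * L2_norm nat_count U"
    unfolding bounded_ops_def L2_nat_count mem_Collect_eq by blast+
  note ext = F_ops(1)
  have add: "F (of_ell2 (x + y)) = L2_add nat_count (F (of_ell2 x)) (F (of_ell2 y))" for x y
    using F_ops(2)[rule_format, OF rangeI rangeI] by simp
  have scale: "F (of_ell2 (c *\<^sub>C x)) = L2_scale nat_count c (F (of_ell2 x))" for c x
    using F_ops(3)[rule_format, OF rangeI] by simp
  obtain C where bdd: "\<And>x. L2_norm nat_count (F (of_ell2 x)) \<le> C * norm x"
    using F_ops(4) by auto
  define f where "f x = to_ell2 (F (of_ell2 x))" for x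
  have F: "F (of_ell2 x) = of_ell2 (f x)" for x
  proof -
    obtain y where "F (of_ell2 x) = of_ell2 y"
      using PiE_mem[OF ext of_ell2_in_L2, of x] unfolding L2_nat_count by blast
    then show ?thesis by (simp add: f_def)
  qed
  have C: "norm (f x) \<le> C * norm x" for x using bdd[of x] by (simp add: F)
  have f_scale: "f (c *\<^sub>C x) = c *\<^sub>C f x" for c x using scale[of c x] by (simp add: F)
  have "bounded_linear f"
  proof (rule bounded_linear_intro[where K = C])
    show "f (x + y) = f x + f y" for x y using add[of x y] by (simp add: F)
    have "r *\<^sub>R x = complex_of_real r *\<^sub>C x" for r x
      by (rule ell2_eqI) (simp add: scaleR_ell2.rep_eq cscale.rep_eq scaleR_conv_of_real)
    then show "f (r *\<^sub>R x) = r *\<^sub>R f x" for r x by (simp add: f_scale)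
    show "norm (f x) \<le> norm x * C" for x using C[of x] by (simp add: mult.commute)
  qed
  then have f: "blinfun_apply (Blinfun f) = f" by (rule bounded_linear_Blinfun_apply)
  have "Blinfun f \<in> clinear_ops" by (simp add: clinear_ops_def f f_scale)
  moreover have "F = restrict F (L2 nat_count)" using ext by (simp add: PiE_restrict)
  then have "F = op_of (Blinfun f)"
    using restrict_eq_op_of[of F "Blinfun f"] by (simp add: F f)
  ultimately show "F \<in> op_of ` clinear_ops" by blast
next
  fix T assume T: "T \<in> clinear_ops"
  show "op_of T \<in> bounded_ops nat_count"
    unfolding bounded_ops_def
  proof (intro CollectI conjI)
    show "op_of T \<in> L2 nat_count \<rightarrow>\<^sub>E L2 nat_count" unfolding op_of_def by auto
    show "\<exists>C. \<forall>U\<in>L2 nat_count. L2_norm nat_count (op_of T U) \<le> C * L2_norm nat_count U"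
      by (rule exI[of _ "norm T"]) (auto simp: L2_nat_count norm_blinfun)
  qed (auto simp: L2_nat_count blinfun.add_right clinear_opsD[OF T])
qed

section \<open>The C*-algebra of bounded operators\<close>

text \<open>The inverse of \<open>op_of\<close> on the carrier. The default 0 makes it a total map
  into \<open>clinear_ops\<close>, so that sums and distances in \<open>L2N\<close> behave well for
  arbitrary arguments.\<close>

definition the_op :: "real L2_op \<Rightarrow> (ell2 \<Rightarrow>\<^sub>L ell2)" where
  "the_op F = (if F \<in> op_of ` clinear_ops then inv_into clinear_ops op_of F else 0)"

lemma the_op_in_clinear_ops [simp]: "the_op F \<in> clinear_ops"
  by (simp add: the_op_def inv_into_into clinear_ops_closed)

lemma the_op_op_of [simp]: "T \<in> clinear_ops \<Longrightarrow> the_op (op_of T) = T"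
  by (simp add: the_op_def inj_on_def inv_into_f_f)

text \<open>
  The locale \<^locale>\<open>Metric_space\<close> requires a distance to be nonnegative and symmetric outside its
  carrier as well. The junk values of \<^const>\<open>L2_operators\<close> violate this, so the sum is redefined
  there; homomorphisms into the algebra do not see the difference.
\<close>

definition L2N :: "real L2_op cstar" where
  "L2N = (L2_operators nat_count)\<lparr>add := \<lambda>F G. op_of (the_op F + the_op G)\<rparr>"

lemma L2N_carrier: "carrier L2N = op_of ` clinear_ops"
  by (simp add: L2N_def L2_operators_def bounded_ops_nat_count)

lemma L2N_mult [simp]: "op_of S \<otimes>\<^bsub>L2N\<^esub> op_of T = op_of (S o\<^sub>L T)"
  by (simp add: L2N_def L2_operators_def) (rule restrict_eq_op_of, simp)

lemma L2N_add: "F \<oplus>\<^bsub>L2N\<^esub> G = op_of (the_op F + the_op G)"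
  by (simp add: L2N_def)

lemma L2_operators_add:
  "S \<in> clinear_ops \<Longrightarrow> T \<in> clinear_ops \<Longrightarrow>
    op_of S \<oplus>\<^bsub>L2_operators nat_count\<^esub> op_of T = op_of S \<oplus>\<^bsub>L2N\<^esub> op_of T"
  by (simp add: L2N_add) (simp add: L2_operators_def, rule restrict_eq_op_of, simp add: blinfun.add_left)

text \<open>A homomorphism only adds values in the carrier, and there the two additions
  agree.\<close>

lemma star_hom_L2N: "star_hom A L2N = star_hom A (L2_operators nat_count)"
proof -
  have carrier: "carrier (L2_operators nat_count) = op_of ` clinear_ops"
    using L2N_carrier by (simp add: L2N_def)
  have "F \<oplus>\<^bsub>L2_operators nat_count\<^esub> G = F \<oplus>\<^bsub>L2N\<^esub> G"
    if "F \<in> op_of ` clinear_ops" "G \<in> op_of ` clinear_ops" for F G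
    using that L2_operators_add by auto
  then have "\<pi> x \<oplus>\<^bsub>L2_operators nat_count\<^esub> \<pi> y = \<pi> x \<oplus>\<^bsub>L2N\<^esub> \<pi> y"
    if "\<pi> \<in> carrier A \<rightarrow>\<^sub>E op_of ` clinear_ops" "x \<in> carrier A" "y \<in> carrier A" for \<pi> x y
    using that by (meson PiE_mem)
  moreover have "mult L2N = mult (L2_operators nat_count)" "star L2N = star (L2_operators nat_count)"
    "smult L2N = smult (L2_operators nat_count)"
    by (simp_all add: L2N_def)
  ultimately show ?thesis
    unfolding star_hom_def L2N_carrier carrier by (auto cong: conj_cong)
qed

lemma L2N_smult [simp]: "c \<odot>\<^bsub>L2N\<^esub> op_of T = op_of (scale_op c T)"
  by (simp add: L2N_def L2_operators_def) (rule restrict_eq_op_of, simp)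

lemma L2N_zero: "\<zero>\<^bsub>L2N\<^esub> = op_of 0"
  by (simp add: L2N_def L2_operators_def L2_zero) (rule restrict_eq_op_of, simp)

text \<open>\<open>op_adjoint\<close> is a definite description: \<open>blinfun_adjoint\<close>
  supplies existence, and uniqueness holds because the inner products determine an operator.\<close>

lemma L2N_star [simp]:
  assumes T: "T \<in> clinear_ops"
  shows "star L2N (op_of T) = op_of (blinfun_adjoint T)"
proof -
  have "op_adjoint nat_count (op_of T) = op_of (blinfun_adjoint T)"
    unfolding op_adjoint_def
  proof (rule the_equality)
    show "op_of (blinfun_adjoint T) \<in> bounded_ops nat_count \<and>
      (\<forall>U\<in>L2 nat_count. \<forall>V\<in>L2 nat_count.
        L2_inner nat_count (op_of T U) V = L2_inner nat_count U (op_of (blinfun_adjoint T) V))"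
      using T by (auto simp: bounded_ops_nat_count L2_nat_count clinear_ops_adjoint
        cinner_blinfun_adjoint)
  next
    fix F
    assume F: "F \<in> bounded_ops nat_count \<and> (\<forall>U\<in>L2 nat_count. \<forall>V\<in>L2 nat_count.
      L2_inner nat_count (op_of T U) V = L2_inner nat_count U (F V))"
    then obtain S where "F = op_of S" by (auto simp: bounded_ops_nat_count)
    with F show "F = op_of (blinfun_adjoint T)"
      using cinner_adjoint_unique[of T S] by (auto simp: L2_nat_count)
  qed
  then show ?thesis by (simp add: L2N_def L2_operators_def)
qed

lemma L2N_cnorm [simp]: "cnorm L2N (op_of T) = norm T"
proof -
  have "{U \<in> L2 nat_count. L2_norm nat_count U \<le> 1} = of_ell2 ` {x. norm x \<le> 1}"
    by (auto simp: L2_nat_count)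
  then have "cnorm L2N (op_of T) = (SUP x\<in>{x. norm x \<le> 1}. norm (T x))"
    by (simp add: L2N_def L2_operators_def image_image)
  also have "\<dots> = norm T"
  proof (rule antisym)
    have le: "norm (T x) \<le> norm T" if "norm x \<le> 1" for x
      using norm_blinfun[of T x] mult_left_mono[OF that, of "norm T"] by simp
    show "(SUP x\<in>{x. norm x \<le> 1}. norm (T x)) \<le> norm T"
      by (rule cSUP_least) (auto simp: le intro: exI[of _ 0])
    have upper: "norm (T x) \<le> (SUP x\<in>{x. norm x \<le> 1}. norm (T x))" if "norm x \<le> 1" for x
      by (rule cSUP_upper2[of _ _ x]) (auto simp: that le intro!: bdd_aboveI2[where M = "norm T"])
    show "norm T \<le> (SUP x\<in>{x. norm x \<le> 1}. norm (T x))"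
    proof (rule norm_blinfun_bound)
      show "0 \<le> (SUP x\<in>{x. norm x \<le> 1}. norm (T x))" using upper[of 0] by simp
      fix x
      show "norm (T x) \<le> (SUP x\<in>{x. norm x \<le> 1}. norm (T x)) * norm x"
      proof (cases "x = 0")
        case False
        then have "norm (T (x /\<^sub>R norm x)) \<le> (SUP x\<in>{x. norm x \<le> 1}. norm (T x))"
          by (intro upper) simp
        then show ?thesis using False by (simp add: blinfun.scaleR_right field_simps)
      qed simp
    qed
  qed
  finally show ?thesis .
qed

lemma L2N_mem [simp]: "op_of T \<in> carrier L2N \<longleftrightarrow> T \<in> clinear_ops"
  by (auto simp: L2N_carrier)

lemma L2N_abelian_group: "abelian_group L2N"
proof (rule abelian_groupI)
  fix x assume "x \<in> carrier L2N"
  then obtain T where "T \<in> clinear_ops" "x = op_of T" by (auto simp: L2N_carrier)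
  then show "\<exists>y\<in>carrier L2N. y \<oplus>\<^bsub>L2N\<^esub> x = \<zero>\<^bsub>L2N\<^esub>"
    by (intro bexI[of _ "op_of (- T)"]) (auto simp: L2N_zero L2N_add clinear_ops_closed)
qed (auto simp: L2N_carrier L2N_zero L2N_add clinear_ops_closed algebra_simps)

text \<open>Holds for every F, as a sum in \<open>L2N\<close> depends on F only through
  \<open>the_op F\<close>. This makes \<open>cdist\<close> the operator distance everywhere, as the
  metric axioms require.\<close>

lemma L2N_a_inv: "\<ominus>\<^bsub>L2N\<^esub> F = op_of (- the_op F)"
  unfolding a_inv_def m_inv_def
proof (rule the_equality)
  fix G assume "G \<in> carrier (add_monoid L2N) \<and> F \<otimes>\<^bsub>add_monoid L2N\<^esub> G = \<one>\<^bsub>add_monoid L2N\<^esub> \<and>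
    G \<otimes>\<^bsub>add_monoid L2N\<^esub> F = \<one>\<^bsub>add_monoid L2N\<^esub>"
  then show "G = op_of (- the_op F)"
    by (auto simp: L2N_carrier L2N_add L2N_zero eq_neg_iff_add_eq_0)
qed (auto simp: L2N_carrier L2N_add L2N_zero clinear_ops_closed)

lemma L2N_minus: "F \<ominus>\<^bsub>L2N\<^esub> G = op_of (the_op F - the_op G)"
  by (simp add: a_minus_def L2N_add L2N_a_inv clinear_ops_closed)

lemma L2N_cdist: "cdist L2N F G = dist (the_op F) (the_op G)"
  by (simp add: cdist_def dist_norm L2N_minus)

lemma L2N_mcomplete: "Metric_space.mcomplete (carrier L2N) (cdist L2N)"
proof -
  interpret Metric_space "carrier L2N" "cdist L2N"
    by unfold_locales (auto simp: L2N_carrier L2N_cdist dist_commute dist_triangle)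
  show ?thesis
    unfolding mcomplete_def
  proof (intro allI impI)
    fix \<sigma> assume \<sigma>: "MCauchy \<sigma>"
    then have "range \<sigma> \<subseteq> carrier L2N" unfolding MCauchy_def by blast
    then have "\<forall>n. \<exists>T. T \<in> clinear_ops \<and> \<sigma> n = op_of T"
      unfolding L2N_carrier by blast
    then obtain X where X: "\<And>n. X n \<in> clinear_ops" "\<And>n. \<sigma> n = op_of (X n)" by metis
    have "Cauchy X"
      using \<sigma> unfolding MCauchy_def Cauchy_def by (simp add: X L2N_cdist)
    then obtain T where T: "X \<longlonglongrightarrow> T" by (auto simp: Cauchy_convergent_iff convergent_def)
    have "T \<in> clinear_ops" by (rule clinear_ops_limit[OF X(1) T])
    then show "\<exists>x. limitin mtopology \<sigma> x sequentially"
      using T unfolding limit_metric_sequentially lim_sequentially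
      by (intro exI[of _ "op_of T"]) (auto simp: X L2N_cdist)
  qed
qed

lemma L2N_cstar_algebra: "cstar_algebra L2N"
proof -
  interpret abelian_group L2N by (rule L2N_abelian_group)
  have bilin: "S o\<^sub>L (T + U) = (S o\<^sub>L T) + (S o\<^sub>L U)" "(S + T) o\<^sub>L U = (S o\<^sub>L U) + (T o\<^sub>L U)"
    for S T U :: "ell2 \<Rightarrow>\<^sub>L ell2"
    by (simp_all add: bounded_bilinear.add_left[OF bounded_bilinear_blinfun_compose]
        bounded_bilinear.add_right[OF bounded_bilinear_blinfun_compose])
  have scale: "scale_op (c + d) T = scale_op c T + scale_op d T"
    "scale_op c (S + T) = scale_op c S + scale_op c T"
    "scale_op (c * d) T = scale_op c (scale_op d T)" "scale_op 1 T = T"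
    "scale_op c S o\<^sub>L T = scale_op c (S o\<^sub>L T)" for c d S T
    by (rule blinfun_eqI; simp add: cscale_simps blinfun.bilinear_simps)+
  have scale_right: "S o\<^sub>L scale_op c T = scale_op c (S o\<^sub>L T)" if "S \<in> clinear_ops" for c S T
    by (rule blinfun_eqI) (simp add: clinear_opsD[OF that])
  have assoc: "(S o\<^sub>L T) o\<^sub>L U = S o\<^sub>L (T o\<^sub>L U)" for S T U :: "ell2 \<Rightarrow>\<^sub>L ell2"
    by (rule blinfun_eqI) simp
  show ?thesis
    by unfold_locales
      (auto simp: L2N_carrier L2N_add clinear_ops_closed clinear_ops_adjoint bilin scale scale_right assoc
        blinfun_adjoint_add blinfun_adjoint_compose blinfun_adjoint_scale_op L2N_zero
        norm_scale_op norm_blinfun_compose norm_triangle_ineq norm_blinfun_adjoint_compose_self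
        intro: L2N_mcomplete[unfolded L2N_carrier])
qed

section \<open>Partial permutations of coordinates\<close>

text \<open>Unordered sums may be restricted to the support of the terms and reindexed along a
  bijection, which the computation of adjoints relies on.\<close>

lemma has_sum_inner: "((\<lambda>n. coord x n \<bullet> coord y n) has_sum (x \<bullet> y)) UNIV"
proof (rule norm_summable_imp_has_sum)
  show "summable (\<lambda>n. norm (coord x n \<bullet> coord y n))"
    by (rule summable_comparison_test'[OF summable_norm_coord_mult[of x y]])
      (simp add: Cauchy_Schwarz_ineq2)
  show "(\<lambda>n. coord x n \<bullet> coord y n) sums (x \<bullet> y)"
    unfolding inner_ell2_def by (rule summable_sums[OF summable_coord_inner])
qed

text \<open>Injectivity makes a finite partial sum a sum over distinct coordinates of x, hence at
  most the squared norm of x.\<close>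

lemma pullback_bound:
  assumes "inj_on g R"
  shows "summable (\<lambda>n. (cmod (if n \<in> R then coord x (g n) else 0))\<^sup>2)" (is "summable ?f")
    and "(\<Sum>n. (cmod (if n \<in> R then coord x (g n) else 0))\<^sup>2) \<le> (norm x)\<^sup>2"
proof -
  have le: "(\<Sum>n<m. ?f n) \<le> (norm x)\<^sup>2" for m
  proof -
    have "(\<Sum>n<m. ?f n) = (\<Sum>n\<in>{..<m} \<inter> R. (cmod (coord x (g n)))\<^sup>2)"
      by (rule sum.mono_neutral_cong_right) auto
    also have "\<dots> = (\<Sum>j\<in>g ` ({..<m} \<inter> R). (cmod (coord x j))\<^sup>2)"
      using inj_on_subset[OF assms, of "{..<m} \<inter> R"] by (subst sum.reindex) auto
    also have "\<dots> \<le> (norm x)\<^sup>2"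
      unfolding norm_ell2_power2 by (rule sum_le_suminf) auto
    finally show ?thesis .
  qed
  show sm: "summable ?f"
    by (rule bounded_imp_summable[where B = "(norm x)\<^sup>2"])
      (use le in \<open>auto simp: lessThan_Suc_atMost[symmetric] simp del: sum.lessThan_Suc\<close>)
  show "(\<Sum>n. ?f n) \<le> (norm x)\<^sup>2" by (rule suminf_le_const[OF sm le])
qed

text \<open>Composition with g on R, extended by zero: the formula for \<open>\<pi> (s e)\<close>
  when g is the inverse of f_e and the derivative is 1.\<close>

definition pullback_op :: "(nat \<Rightarrow> nat) \<Rightarrow> nat set \<Rightarrow> ell2 \<Rightarrow>\<^sub>L ell2" where
  "pullback_op g R = Blinfun (\<lambda>x. Abs_ell2 (\<lambda>n. if n \<in> R then coord x (g n) else 0))"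

lemma coord_pullback_op:
  assumes "inj_on g R"
  shows "coord (pullback_op g R x) n = (if n \<in> R then coord x (g n) else 0)"
proof -
  let ?F = "\<lambda>x. Abs_ell2 (\<lambda>n. if n \<in> R then coord x (g n) else 0)"
  have F: "coord (?F x) = (\<lambda>n. if n \<in> R then coord x (g n) else 0)" for x
    by (rule coord_Abs_ell2) (rule pullback_bound(1)[OF assms])
  have "bounded_linear ?F"
  proof (rule bounded_linear_intro[where K = 1])
    show "?F (x + y) = ?F x + ?F y" for x y
      by (rule ell2_eqI) (subst F, simp only: plus_ell2.rep_eq F, simp)
    show "?F (r *\<^sub>R x) = r *\<^sub>R ?F x" for r x
      by (rule ell2_eqI) (subst F, simp only: scaleR_ell2.rep_eq F, simp)
    fix x
    have "(norm (?F x))\<^sup>2 \<le> (norm x)\<^sup>2"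
      unfolding norm_ell2_power2[of "?F x"] F by (rule pullback_bound(2)[OF assms])
    then have "norm (?F x) \<le> norm x" by (rule power2_le_imp_le) simp
    then show "norm (?F x) \<le> norm x * 1" by simp
  qed
  then have "pullback_op g R x = ?F x"
    unfolding pullback_op_def by (simp add: bounded_linear_Blinfun_apply)
  then show ?thesis by (simp add: F)
qed

lemma pullback_op_clinear: "inj_on g R \<Longrightarrow> pullback_op g R \<in> clinear_ops"
  unfolding clinear_ops_def by (auto intro!: ell2_eqI simp: coord_pullback_op cscale.rep_eq)

lemma adjoint_pullback_op:
  assumes g: "bij_betw g R D" and f: "\<And>m. m \<in> D \<Longrightarrow> f m \<in> R \<and> g (f m) = m"
  shows "blinfun_adjoint (pullback_op g R) = pullback_op f D"
proof (rule blinfun_adjoint_unique)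
  fix x y
  have bij: "bij_betw f D R"
    by (rule bij_betw_byWitness[where f' = g])
      (use g f in \<open>auto simp: bij_betw_def inj_on_def\<close>)
  have inj: "inj_on g R" "inj_on f D" using g bij by (auto simp: bij_betw_def)
  have "((\<lambda>n. coord (pullback_op g R x) n \<bullet> coord y n) has_sum (pullback_op g R x \<bullet> y)) UNIV"
    by (rule has_sum_inner)
  then have "((\<lambda>n. coord x (g n) \<bullet> coord y n) has_sum (pullback_op g R x \<bullet> y)) R"
    by (rule has_sum_cong_neutral[THEN iffD1, rotated 3]) (auto simp: coord_pullback_op[OF inj(1)])
  then have "((\<lambda>m. coord x (g (f m)) \<bullet> coord y (f m)) has_sum (pullback_op g R x \<bullet> y)) D"
    by (subst has_sum_reindex_bij_betw[OF bij])
  then have "((\<lambda>m. coord x m \<bullet> coord (pullback_op f D y) m) has_sum (pullback_op g R x \<bullet> y)) UNIV"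
    by (rule has_sum_cong_neutral[THEN iffD1, rotated 3])
      (auto simp: coord_pullback_op[OF inj(2)] f)
  then show "pullback_op g R x \<bullet> y = x \<bullet> pullback_op f D y"
    using has_sum_inner has_sum_unique by blast
qed

definition proj_op :: "nat set \<Rightarrow> ell2 \<Rightarrow>\<^sub>L ell2" where
  "proj_op D = pullback_op (\<lambda>n. n) D"

lemma coord_proj_op [simp]: "coord (proj_op D x) n = (if n \<in> D then coord x n else 0)"
  by (simp add: proj_op_def coord_pullback_op)

lemma proj_op_clinear [simp]: "proj_op D \<in> clinear_ops"
  by (simp add: proj_op_def pullback_op_clinear)

lemma adjoint_proj_op [simp]: "blinfun_adjoint (proj_op D) = proj_op D"
  unfolding proj_op_def by (rule adjoint_pullback_op) (auto simp: bij_betw_def)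

lemma proj_op_compose [simp]: "proj_op D o\<^sub>L proj_op E = proj_op (D \<inter> E)"
  by (rule blinfun_eqI, rule ell2_eqI) simp

lemma proj_op_empty [simp]: "proj_op {} = 0"
  by (rule blinfun_eqI, rule ell2_eqI) (simp add: zero_ell2.rep_eq)

lemma proj_op_diff: "E \<subseteq> D \<Longrightarrow> proj_op D - proj_op E = proj_op (D - E)"
  by (rule blinfun_eqI, rule ell2_eqI) (auto simp: blinfun.diff_left minus_ell2.rep_eq)

lemma proj_op_Un: "D \<inter> E = {} \<Longrightarrow> proj_op D + proj_op E = proj_op (D \<union> E)"
  by (rule blinfun_eqI, rule ell2_eqI) (auto simp: blinfun.add_left plus_ell2.rep_eq)

text \<open>Evaluation at a unit vector supported in D reads off the scalar. The result serves
  twice: to tell p_v from its negative, and, with scalars 0 and 1, to see that the projections do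
  not vanish.\<close>

lemma scale_proj_op_inject:
  assumes "D \<noteq> {}"
  shows "scale_op c (proj_op D) = scale_op d (proj_op D) \<longleftrightarrow> c = d"
proof
  obtain n where "n \<in> D" using assms by blast
  let ?x = "Abs_ell2 (\<lambda>k. if k = n then 1 else 0)"
  have "summable (\<lambda>k. (cmod (if k = n then 1 else 0))\<^sup>2)"
    by (rule summable_finite[of "{n}"]) auto
  then have "coord ?x n = 1" by (simp add: coord_Abs_ell2)
  moreover assume "scale_op c (proj_op D) = scale_op d (proj_op D)"
  then have "coord (scale_op c (proj_op D) ?x) n = coord (scale_op d (proj_op D) ?x) n" by simp
  ultimately show "c = d" using \<open>n \<in> D\<close> by (simp add: cscale.rep_eq)
qed simp

lemma scale_op_one [simp]: "scale_op 1 T = T"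
  by (rule blinfun_eqI) (simp add: cscale_simps)

lemma scale_op_zero [simp]: "scale_op 0 T = 0"
  by (rule blinfun_eqI, rule ell2_eqI) (simp add: cscale.rep_eq zero_ell2.rep_eq)

lemma scale_op_compose: "S \<in> clinear_ops \<Longrightarrow> scale_op c S o\<^sub>L scale_op d T = scale_op (c * d) (S o\<^sub>L T)"
  by (rule blinfun_eqI) (simp add: clinear_opsD cscale_simps)

lemma finsum_proj_op:
  assumes "finite F" "\<And>e e'. e \<in> F \<Longrightarrow> e' \<in> F \<Longrightarrow> e \<noteq> e' \<Longrightarrow> R e \<inter> R e' = {}"
  shows "(\<Oplus>\<^bsub>L2N\<^esub>e\<in>F. op_of (proj_op (R e))) = op_of (proj_op (\<Union>e\<in>F. R e))"
proof -
  interpret abelian_group L2N by (rule L2N_abelian_group)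
  show ?thesis
    using assms
  proof (induction F)
    case empty
    then show ?case by (simp add: L2N_zero)
  next
    case (insert e F)
    then have "R e \<inter> (\<Union>e\<in>F. R e) = {}" by blast
    with insert show ?case by (subst finsum_insert) (auto simp: L2N_add proj_op_Un)
  qed
qed


section \<open>The branching system\<close>

text \<open>A word is folded onto a starting element x because the algebra may have no unit; for a
  cycle, x is the projection at its base vertex.\<close>

lemma cstar_algebra_foldr_closed:
  assumes "cstar_algebra A" "\<And>e. e \<in> set \<alpha> \<Longrightarrow> s e \<in> carrier A" "x \<in> carrier A"
  shows "foldr (\<lambda>e y. s e \<otimes>\<^bsub>A\<^esub> y) \<alpha> x \<in> carrier A"
  using assms by (induction \<alpha>) (auto intro: cstar_algebra.mult_closed)

lemma star_hom_foldr:
  assumes "cstar_algebra A" "\<pi> \<in> star_hom A B" "\<And>e. e \<in> set \<alpha> \<Longrightarrow> s e \<in> carrier A" "x \<in> carrier A"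
  shows "\<pi> (foldr (\<lambda>e y. s e \<otimes>\<^bsub>A\<^esub> y) \<alpha> x) = foldr (\<lambda>e y. \<pi> (s e) \<otimes>\<^bsub>B\<^esub> y) \<alpha> (\<pi> x)"
  using assms(3)
proof (induction \<alpha>)
  case (Cons e \<alpha>)
  have "foldr (\<lambda>e y. s e \<otimes>\<^bsub>A\<^esub> y) \<alpha> x \<in> carrier A"
    using Cons.prems by (intro cstar_algebra_foldr_closed[OF assms(1) _ assms(4)]) auto
  with Cons assms(2) show ?case by (simp add: star_hom_def)
qed simp

text \<open>
  The block \<open>code v\<close> of natural numbers carries the vertex \<open>v\<close>, and \<open>emb e\<close> places a copy of the
  block of the range of \<open>e\<close> inside the block of its source.
\<close>

locale nat_branching = wf_digraph G for G :: "('v, 'e) pre_digraph" +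
  fixes code :: "'v \<Rightarrow> nat \<Rightarrow> nat" and emb :: "'e \<Rightarrow> nat \<Rightarrow> nat"
  assumes code_eq_iff: "v \<in> verts G \<Longrightarrow> w \<in> verts G \<Longrightarrow> code v m = code w n \<longleftrightarrow> v = w \<and> m = n"
    and emb_eq_iff: "e \<in> arcs G \<Longrightarrow> e' \<in> arcs G \<Longrightarrow> tail G e = tail G e' \<Longrightarrow>
      emb e m = emb e' n \<longleftrightarrow> e = e' \<and> m = n"
    and emb_onto: "v \<in> verts G \<Longrightarrow> out_arcs G v \<noteq> {} \<Longrightarrow> \<exists>e\<in>out_arcs G v. \<exists>n. emb e n = m"
    and emb_single: "out_arcs G (tail G e) = {e} \<Longrightarrow> emb e n = n"
begin

definition D :: "'v \<Rightarrow> nat set" where "D v = range (code v)"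

definition R :: "'e \<Rightarrow> nat set" where "R e = range (\<lambda>n. code (tail G e) (emb e n))"

definition fwd :: "'e \<Rightarrow> nat \<Rightarrow> nat" where
  "fwd e m = code (tail G e) (emb e (inv_into UNIV (code (head G e)) m))"

definition bwd :: "'e \<Rightarrow> nat \<Rightarrow> nat" where
  "bwd e m = code (head G e) (inv_into UNIV (\<lambda>n. code (tail G e) (emb e n)) m)"

lemma fwd_code [simp]: "e \<in> arcs G \<Longrightarrow> fwd e (code (head G e) n) = code (tail G e) (emb e n)"
  unfolding fwd_def by (subst inv_f_f) (auto intro!: injI simp: code_eq_iff)

lemma bwd_code [simp]: "e \<in> arcs G \<Longrightarrow> bwd e (code (tail G e) (emb e n)) = code (head G e) n"
  unfolding bwd_def
  by (subst inv_f_f[where f = "\<lambda>n. code (tail G e) (emb e n)"])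
    (auto intro!: injI simp: code_eq_iff emb_eq_iff)

lemma bij_fwd: "e \<in> arcs G \<Longrightarrow> bij_betw (fwd e) (D (head G e)) (R e)"
  by (rule bij_betw_byWitness[where f' = "bwd e"]) (auto simp: D_def R_def)

lemma bij_bwd: "e \<in> arcs G \<Longrightarrow> bij_betw (bwd e) (R e) (D (head G e))"
  by (rule bij_betw_byWitness[where f' = "fwd e"]) (auto simp: D_def R_def)

lemma fwd_bwd: "e \<in> arcs G \<Longrightarrow> m \<in> R e \<Longrightarrow> fwd e (bwd e m) = m"
  by (auto simp: R_def)

lemma bwd_fwd: "e \<in> arcs G \<Longrightarrow> m \<in> D (head G e) \<Longrightarrow> bwd e (fwd e m) = m"
  by (auto simp: D_def)

lemma D_disjoint: "v \<in> verts G \<Longrightarrow> w \<in> verts G \<Longrightarrow> v \<noteq> w \<Longrightarrow> D v \<inter> D w = {}"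
  by (auto simp: D_def code_eq_iff)

lemma D_nonempty [simp]: "D v \<noteq> {}"
  by (simp add: D_def)

lemma R_disjoint: "e \<in> arcs G \<Longrightarrow> e' \<in> arcs G \<Longrightarrow> e \<noteq> e' \<Longrightarrow> R e \<inter> R e' = {}"
  by (auto simp: R_def code_eq_iff emb_eq_iff)

lemma R_subset: "R e \<subseteq> D (tail G e)"
  by (auto simp: R_def D_def)

lemma D_eq_Union: "v \<in> verts G \<Longrightarrow> out_arcs G v \<noteq> {} \<Longrightarrow> D v = (\<Union>e\<in>out_arcs G v. R e)"
proof (rule equalityI)
  assume v: "v \<in> verts G" "out_arcs G v \<noteq> {}"
  show "D v \<subseteq> (\<Union>e\<in>out_arcs G v. R e)"
  proof
    fix m assume "m \<in> D v"
    then obtain k where k: "m = code v k" by (auto simp: D_def)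
    obtain e n where "e \<in> out_arcs G v" "emb e n = k" using emb_onto[OF v] by blast
    then show "m \<in> (\<Union>e\<in>out_arcs G v. R e)" unfolding k by (fastforce simp: R_def)
  qed
qed (use R_subset in fastforce)

section \<open>Transport of the blocks and maps to the real line\<close>

abbreviation rD :: "'v \<Rightarrow> real set" where "rD v \<equiv> real ` D v"
abbreviation rR :: "'e \<Rightarrow> real set" where "rR e \<equiv> real ` R e"
abbreviation rfwd :: "'e \<Rightarrow> real \<Rightarrow> real" where "rfwd e x \<equiv> real (fwd e (nat \<lfloor>x\<rfloor>))"
abbreviation rbwd :: "'e \<Rightarrow> real \<Rightarrow> real" where "rbwd e x \<equiv> real (bwd e (nat \<lfloor>x\<rfloor>))"

lemma restrict_nat_count: "restrict_space nat_count (real ` N) = count_space (real ` N)"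
  by (simp add: restrict_count_space Int_absorb2 image_mono)

lemma bij_rfwd: "e \<in> arcs G \<Longrightarrow> bij_betw (rfwd e) (rD (head G e)) (rR e)"
  by (rule bij_betw_byWitness[where f' = "rbwd e"])
    (auto simp: fwd_bwd bwd_fwd dest: bij_fwd[THEN bij_betw_apply] bij_bwd[THEN bij_betw_apply])

lemma bij_rbwd: "e \<in> arcs G \<Longrightarrow> bij_betw (rbwd e) (rR e) (rD (head G e))"
  by (rule bij_betw_byWitness[where f' = "rfwd e"])
    (auto simp: fwd_bwd bwd_fwd dest: bij_fwd[THEN bij_betw_apply] bij_bwd[THEN bij_betw_apply])

text \<open>The set relations hold exactly, and a bijection carries counting measure to counting
  measure, so each pushforward equals the measure it is compared with.\<close>

lemma branching_system: "branching_system G nat_count rR rD rfwd rbwd"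
proof -
  have inter: "real ` M \<inter> real ` N = real ` (M \<inter> N)" for M N by auto
  have tail_diff: "rR e - rD (tail G e) = {}" for e using R_subset by auto
  have union: "sym_diff (rD v) (\<Union>e\<in>out_arcs G v. rR e) = {}"
    if "v \<in> verts G" "out_arcs G v \<noteq> {}" for v
    using D_eq_Union[OF that] by auto
  have maps: "rfwd e \<in> measurable (count_space (rD (head G e))) (count_space (rR e)) \<and>
      rbwd e \<in> measurable (count_space (rR e)) (count_space (rD (head G e))) \<and>
      (AE x in count_space (rR e). rfwd e (rbwd e x) = x) \<and>
      (AE x in count_space (rD (head G e)). rbwd e (rfwd e x) = x) \<and>
      absolutely_continuous (count_space (rD (head G e)))
        (distr (count_space (rR e)) (count_space (rD (head G e))) (rbwd e)) \<and>
      absolutely_continuous (count_space (rR e))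
        (distr (count_space (rD (head G e))) (count_space (rR e)) (rfwd e))"
    if e: "e \<in> arcs G" for e
    unfolding distr_bij_count_space[OF bij_rfwd[OF e]] distr_bij_count_space[OF bij_rbwd[OF e]]
    using bij_betw_imp_funcset[OF bij_rfwd[OF e]] bij_betw_imp_funcset[OF bij_rbwd[OF e]] e
    by (auto simp: absolutely_continuous_def AE_count_space fwd_bwd bwd_fwd)
  show ?thesis
    unfolding branching_system_def Let_def restrict_nat_count inter
    using maps by (simp add: image_mono D_disjoint R_disjoint tail_diff union)
qed

text \<open>The pushforward is counting measure itself, so its derivative is 1 almost everywhere,
  which here means everywhere.\<close>

lemma branching_RN:
  assumes "e \<in> arcs G" "x \<in> rR e"
  shows "branching_RN G nat_count rR rD rfwd e x = 1"
proof -
  have "sigma_finite_measure (count_space (rR e))"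
    by (rule sigma_finite_measure_count_space_countable) simp
  then have "AE x in count_space (rR e). 1 = RN_deriv (count_space (rR e)) (count_space (rR e)) x"
    by (intro RN_deriv_unique_sigma_finite) (auto simp: density_1)
  then show ?thesis
    unfolding branching_RN_def restrict_nat_count distr_bij_count_space[OF bij_rfwd[OF assms(1)]]
    using assms(2) by (fastforce simp: AE_count_space)
qed

section \<open>The edge operators, their twists and the Cuntz-Krieger relations\<close>

definition V :: "'e \<Rightarrow> ell2 \<Rightarrow>\<^sub>L ell2" where "V e = pullback_op (bwd e) (R e)"

lemma coord_V: "e \<in> arcs G \<Longrightarrow> coord (V e x) n = (if n \<in> R e then coord x (bwd e n) else 0)"
  using bij_bwd[of e] by (simp add: V_def coord_pullback_op bij_betw_def)

lemma V_clinear: "e \<in> arcs G \<Longrightarrow> V e \<in> clinear_ops"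
  using bij_bwd[of e] by (simp add: V_def pullback_op_clinear bij_betw_def)

lemma adjoint_V: "e \<in> arcs G \<Longrightarrow> blinfun_adjoint (V e) = pullback_op (fwd e) (D (head G e))"
  unfolding V_def
  by (rule adjoint_pullback_op) (auto simp: bij_bwd bwd_fwd bij_betw_apply[OF bij_fwd])

lemma coord_adjoint_V:
  "e \<in> arcs G \<Longrightarrow>
    coord (blinfun_adjoint (V e) x) n = (if n \<in> D (head G e) then coord x (fwd e n) else 0)"
  using bij_fwd[of e] by (simp add: adjoint_V coord_pullback_op bij_betw_def)

lemma V_adjoint_V: "e \<in> arcs G \<Longrightarrow> V e o\<^sub>L blinfun_adjoint (V e) = proj_op (R e)"
  by (rule blinfun_eqI, rule ell2_eqI)
    (auto simp: coord_V coord_adjoint_V fwd_bwd dest: bij_bwd[THEN bij_betw_apply])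

lemma adjoint_V_V: "e \<in> arcs G \<Longrightarrow> blinfun_adjoint (V e) o\<^sub>L V e = proj_op (D (head G e))"
  by (rule blinfun_eqI, rule ell2_eqI)
    (auto simp: coord_V coord_adjoint_V bwd_fwd dest: bij_fwd[THEN bij_betw_apply])

lemma proj_V: "e \<in> arcs G \<Longrightarrow> proj_op (R e) o\<^sub>L V e = V e"
  by (rule blinfun_eqI, rule ell2_eqI) (auto simp: coord_V)

text \<open>For z of modulus one the scalars cancel in each s_e s_e* and s_e* s_e, so the relations
  for the twisted family reduce to those for z = 1. That case gives the induced representation, a
  root of -1 the one used for comparison.\<close>

lemma ck_family_twisted:
  assumes z: "cmod z = 1"
  shows "ck_family G L2N (\<lambda>v. op_of (proj_op (D v))) (\<lambda>e. op_of (scale_op z (V e)))"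
proof -
  let ?s = "\<lambda>e. op_of (scale_op z (V e))"
  have zz: "z * cnj z = 1" "cnj z * z = 1"
    using complex_norm_square[of z] z by (simp_all add: mult.commute)
  have star: "star L2N (?s e) = op_of (scale_op (cnj z) (blinfun_adjoint (V e)))"
    if "e \<in> arcs G" for e
    by (simp add: that V_clinear clinear_ops_closed blinfun_adjoint_scale_op)
  have range: "range_proj L2N (?s e) = op_of (proj_op (R e))" if "e \<in> arcs G" for e
    by (simp add: range_proj_def star that scale_op_compose V_clinear zz V_adjoint_V)
  have source: "star L2N (?s e) \<otimes>\<^bsub>L2N\<^esub> ?s e = op_of (proj_op (D (head G e)))"
    if "e \<in> arcs G" for e
    by (simp add: star that scale_op_compose V_clinear clinear_ops_adjoint zz adjoint_V_V)
  have pisom: "partial_isometry L2N (?s e)" if "e \<in> arcs G" for e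
  proof -
    have "range_proj L2N (?s e) \<otimes>\<^bsub>L2N\<^esub> ?s e = ?s e"
      using scale_op_compose[of "proj_op (R e)" 1 z "V e"] by (simp add: range that proj_V)
    then show ?thesis
      by (simp add: partial_isometry_def range_proj_def that V_clinear clinear_ops_closed)
  qed
  \<comment> \<open>The difference of nested projections is again a projection q, and q = q* q
    exhibits it as positive.\<close>
  have le: "cstar_le L2N (op_of (proj_op (R e))) (op_of (proj_op (D (tail G e))))" for e
    unfolding cstar_le_def
    by (auto simp: L2N_minus proj_op_diff[OF R_subset]
        intro!: bexI[of _ "op_of (proj_op (D (tail G e) - R e))"])
  have sum: "op_of (proj_op (D v)) = (\<Oplus>\<^bsub>L2N\<^esub>e\<in>out_arcs G v. range_proj L2N (?s e))"
    if "v \<in> verts G" "out_arcs G v \<noteq> {}" "finite (out_arcs G v)" for v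
  proof -
    interpret L: abelian_group L2N by (rule L2N_abelian_group)
    have "(\<Oplus>\<^bsub>L2N\<^esub>e\<in>out_arcs G v. range_proj L2N (?s e)) =
        (\<Oplus>\<^bsub>L2N\<^esub>e\<in>out_arcs G v. op_of (proj_op (R e)))"
      by (rule L.finsum_cong') (auto simp: range)
    also have "\<dots> = op_of (proj_op (D v))"
      by (subst finsum_proj_op) (auto simp: that R_disjoint D_eq_Union)
    finally show ?thesis ..
  qed
  show ?thesis
    unfolding ck_family_def projection_def
    by (auto simp: pisom range source le sum[symmetric] R_disjoint D_disjoint L2N_zero)
qed

text \<open>Being induced becomes a prescription of values on the generators, the form in which
  universality yields existence and uniqueness.\<close>

lemma induced_representation_iff:
  assumes "ck_family G A p s"
  shows "induced_representation G A p s nat_count rR rD rfwd rbwd \<pi> \<longleftrightarrow>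
    \<pi> \<in> star_hom A L2N \<and> (\<forall>v\<in>verts G. \<pi> (p v) = op_of (proj_op (D v))) \<and>
    (\<forall>e\<in>arcs G. \<pi> (s e) = op_of (V e))"
proof -
  have carrier: "v \<in> verts G \<Longrightarrow> p v \<in> carrier A" "e \<in> arcs G \<Longrightarrow> s e \<in> carrier A" for v e
    using assms by (auto simp: ck_family_def projection_def partial_isometry_def)
  have edge: "L2_class nat_count (\<lambda>x. if x \<in> rR e
      then complex_of_real (sqrt (branching_RN G nat_count rR rD rfwd e x)) * \<phi> (rbwd e x) else 0) =
      op_of (V e) (L2_class nat_count \<phi>)" if "e \<in> arcs G" "\<phi> \<in> L2_fun nat_count" for e \<phi>
  proof -
    obtain x where x: "\<And>n. coord x n = \<phi> (real n)" "L2_class nat_count \<phi> = of_ell2 x"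
      using L2_class_coordE[OF \<open>\<phi> \<in> L2_fun nat_count\<close>] by blast
    show ?thesis
      unfolding x(2) op_of_apply using \<open>e \<in> arcs G\<close>
      by (intro L2_class_coord) (auto simp: coord_V x(1) branching_RN image_iff)
  qed
  have vertex: "L2_class nat_count (\<lambda>x. indicator (rD v) x * \<phi> x) =
      op_of (proj_op (D v)) (L2_class nat_count \<phi>)" if "\<phi> \<in> L2_fun nat_count" for v \<phi>
  proof -
    obtain x where x: "\<And>n. coord x n = \<phi> (real n)" "L2_class nat_count \<phi> = of_ell2 x"
      using L2_class_coordE[OF \<open>\<phi> \<in> L2_fun nat_count\<close>] by blast
    show ?thesis
      unfolding x(2) op_of_apply
      by (intro L2_class_coord) (auto simp: x(1) indicator_def image_iff)
  qed
  have eq: "(\<forall>\<phi>\<in>L2_fun nat_count. \<pi> a (L2_class nat_count \<phi>) = op_of T (L2_class nat_count \<phi>)) \<longleftrightarrow>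
      \<pi> a = op_of T" if hom: "\<pi> \<in> star_hom A L2N" and "a \<in> carrier A" for a T
  proof
    assume *: "\<forall>\<phi>\<in>L2_fun nat_count. \<pi> a (L2_class nat_count \<phi>) = op_of T (L2_class nat_count \<phi>)"
    have "\<pi> a \<in> carrier L2N" using that by (auto simp: star_hom_def)
    then obtain S where S: "\<pi> a = op_of S" by (auto simp: L2N_carrier)
    have "S x = T x" for x
      using *[rule_format, OF of_ell2_rep_in_L2_fun[of x]] unfolding of_ell2_def[symmetric] S by simp
    then show "\<pi> a = op_of T" using S blinfun_eqI by blast
  qed simp
  show ?thesis
    unfolding induced_representation_def star_hom_L2N[symmetric]
    by (auto simp: edge vertex eq carrier)
qed

text \<open>Where the tail emits only e, \<open>V e\<close> moves position n of the block of the
  head to position n of the block of the tail. The induction peels off initial edges, so it needs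
  walks with distinct ends and the fact that the result is supported in the block of u.\<close>

lemma coord_foldr_V:
  assumes "awalk u \<alpha> v" "\<forall>e\<in>set \<alpha>. out_arcs G (tail G e) = {e}"
  shows "coord (foldr (\<lambda>e Y. scale_op z (V e) o\<^sub>L Y) \<alpha> (proj_op (D v)) x) (code u n) =
      z ^ length \<alpha> * coord x (code v n) \<and>
    (m \<notin> D u \<longrightarrow> coord (foldr (\<lambda>e Y. scale_op z (V e) o\<^sub>L Y) \<alpha> (proj_op (D v)) x) m = 0)"
  using assms
proof (induction \<alpha> arbitrary: u n m)
  case Nil
  then show ?case by (auto simp: awalk_Nil_iff D_def)
next
  case (Cons e \<alpha>)
  then have e: "e \<in> arcs G" "u = tail G e" "awalk (head G e) \<alpha> v" by (auto simp: awalk_Cons_iff)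
  have emb: "emb e n = n" for n using Cons.prems(2) by (intro emb_single) auto
  then have "code u n \<in> R e" "bwd e (code u n) = code (head G e) n"
    using bwd_code[OF e(1), of n] by (auto simp: R_def e(2))
  with Cons.IH[OF e(3)] Cons.prems(2) e R_subset[of e] show ?case
    by (auto simp: coord_V cscale.rep_eq)
qed

lemma foldr_V_closed:
  assumes "awalk v \<alpha> v" "\<forall>e\<in>set \<alpha>. out_arcs G (tail G e) = {e}"
  shows "foldr (\<lambda>e Y. scale_op z (V e) o\<^sub>L Y) \<alpha> (proj_op (D v)) =
    scale_op (z ^ length \<alpha>) (proj_op (D v))"
proof (rule blinfun_eqI, rule ell2_eqI)
  fix x m
  show "coord (foldr (\<lambda>e Y. scale_op z (V e) o\<^sub>L Y) \<alpha> (proj_op (D v)) x) m =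
      coord (scale_op (z ^ length \<alpha>) (proj_op (D v)) x) m"
    using coord_foldr_V[OF assms, where z = z and x = x and m = m]
    by (cases "m \<in> D v") (auto simp: cscale.rep_eq D_def)
qed

lemma star_hom_closed_walk:
  assumes "cstar_algebra A" "ck_family G A p s" "\<pi> \<in> star_hom A L2N"
    and "\<forall>v\<in>verts G. \<pi> (p v) = op_of (proj_op (D v))"
    and "\<forall>e\<in>arcs G. \<pi> (s e) = op_of (scale_op z (V e))"
    and "awalk v \<alpha> v" "\<forall>e\<in>set \<alpha>. out_arcs G (tail G e) = {e}"
  shows "\<pi> (foldr (\<lambda>e y. s e \<otimes>\<^bsub>A\<^esub> y) \<alpha> (p v)) = op_of (scale_op (z ^ length \<alpha>) (proj_op (D v)))"
proof -
  have v: "v \<in> verts G" and \<alpha>: "set \<alpha> \<subseteq> arcs G" using assms(6) by (auto simp: awalk_def)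
  have "\<pi> (foldr (\<lambda>e y. s e \<otimes>\<^bsub>A\<^esub> y) \<alpha> (p v)) = foldr (\<lambda>e y. \<pi> (s e) \<otimes>\<^bsub>L2N\<^esub> y) \<alpha> (\<pi> (p v))"
    using assms(2) v \<alpha>
    by (intro star_hom_foldr assms) (auto simp: ck_family_def partial_isometry_def projection_def)
  also have "\<dots> = foldr (\<lambda>e y. op_of (scale_op z (V e)) \<otimes>\<^bsub>L2N\<^esub> y) \<alpha> (op_of (proj_op (D v)))"
    using assms(4,5) v \<alpha> by (intro foldr_cong) auto
  also have "\<dots> = op_of (foldr (\<lambda>e Y. scale_op z (V e) o\<^sub>L Y) \<alpha> (proj_op (D v)))"
    by (induction \<alpha>) simp_all
  finally show ?thesis by (simp add: foldr_V_closed[OF assms(6,7)])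
qed

end

section \<open>Construction of the blocks and their splittings for a countable graph\<close>

lemma exists_nat_branching:
  assumes "countable_digraph G"
  shows "\<exists>code emb. nat_branching G code emb"
proof -
  interpret wf_digraph G using assms by (simp add: countable_digraph_def)
  have countable: "countable (verts G)" "countable (arcs G)"
    using assms by (simp_all add: countable_digraph_def)
  define code where "code v n = prod_encode (to_nat_on (verts G) v, n)" for v n
  have "\<exists>k. (out_arcs G v \<noteq> {} \<longrightarrow> bij_betw k (out_arcs G v \<times> (UNIV :: nat set)) (UNIV :: nat set)) \<and>
      (\<forall>e. out_arcs G v = {e} \<longrightarrow> (\<forall>n. k (e, n) = n))" for v
  proof (cases "\<exists>e. out_arcs G v = {e}")
    \<comment> \<open>For a single edge e, \<open>snd\<close> identifies {e} x nat with nat. This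
      choice makes \<open>emb e\<close> the identity; an arbitrary bijection could permute the
      block.\<close>
    case True
    then show ?thesis
      by (intro exI[of _ snd]) (auto simp: bij_betw_def inj_on_def image_iff)
  next
    case False
    let ?S = "out_arcs G v \<times> (UNIV :: nat set)"
    have "countable ?S"
      using countable(2) by (intro countable_SIGMA) (auto simp: out_arcs_def intro: countable_subset)
    \<comment> \<open>The product with nat is infinite and countable whether v emits finitely or
      infinitely many edges, so its enumeration is a bijection onto nat.\<close>
    then have "out_arcs G v \<noteq> {} \<longrightarrow> bij_betw (to_nat_on ?S) ?S UNIV"
      by (auto intro!: to_nat_on_infinite simp: finite_cartesian_product_iff)
    with False show ?thesis by (intro exI[of _ "to_nat_on ?S"]) simp
  qed
  then have "\<exists>k. \<forall>v. (out_arcs G v \<noteq> {} \<longrightarrow>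
        bij_betw (k v) (out_arcs G v \<times> (UNIV :: nat set)) (UNIV :: nat set)) \<and>
      (\<forall>e. out_arcs G v = {e} \<longrightarrow> (\<forall>n. k v (e, n) = n))"
    by (intro choice allI)
  then obtain k where
    k: "\<And>v. out_arcs G v \<noteq> {} \<Longrightarrow>
      bij_betw (k v) (out_arcs G v \<times> (UNIV :: nat set)) (UNIV :: nat set)"
    and k_single: "\<And>v e n. out_arcs G v = {e} \<Longrightarrow> k v (e, n) = n"
    by blast
  define emb where "emb e n = k (tail G e) (e, n)" for e n
  have "nat_branching G code emb"
  proof
    show "code v m = code w n \<longleftrightarrow> v = w \<and> m = n" if "v \<in> verts G" "w \<in> verts G" for v w m n
      using that countable(1) by (simp add: code_def)
    show "emb e m = emb e' n \<longleftrightarrow> e = e' \<and> m = n"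
      if "e \<in> arcs G" "e' \<in> arcs G" "tail G e = tail G e'" for e e' m n
    proof -
      have "e \<in> out_arcs G (tail G e)" "e' \<in> out_arcs G (tail G e)"
        using that by (auto simp: out_arcs_def)
      then have "inj_on (k (tail G e)) (out_arcs G (tail G e) \<times> UNIV)"
        using k[of "tail G e"] unfolding bij_betw_def by blast
      then have "k (tail G e) (e, m) = k (tail G e) (e', n) \<longleftrightarrow> (e, m) = (e', n)"
        using \<open>e \<in> out_arcs G _\<close> \<open>e' \<in> out_arcs G _\<close> by (intro inj_on_eq_iff) auto
      then show ?thesis by (simp add: emb_def that(3))
    qed
    show "\<exists>e\<in>out_arcs G v. \<exists>n. emb e n = m" if "v \<in> verts G" "out_arcs G v \<noteq> {}" for v m
    proof -
      have "m \<in> k v ` (out_arcs G v \<times> UNIV)" using k[OF that(2)] by (simp add: bij_betw_def)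
      then show ?thesis by (auto simp: emb_def out_arcs_def)
    qed
    show "emb e n = n" if "out_arcs G (tail G e) = {e}" for e n
      using k_single[OF that] by (simp add: emb_def)
  qed
  then show ?thesis by blast
qed

theorem theorem3p5:
  fixes G :: "('v, 'e) pre_digraph"
    and A :: "'a cstar" and p :: "'v \<Rightarrow> 'a" and s :: "'e \<Rightarrow> 'a"
  assumes "countable_digraph G"
    and "graph_cstar_algebra TYPE(real L2_op) G A p s"
    and "\<not> condition_L G"
  shows "\<exists>(M :: real measure) R D f g.
    sigma_finite_measure M \<and> branching_system G M R D f g \<and>
    (\<exists>!\<pi>. induced_representation G A p s M R D f g \<pi>) \<and>
    (\<forall>\<pi>. induced_representation G A p s M R D f g \<pi> \<longrightarrow>
       (\<forall>v\<in>verts G. \<pi> (p v) \<noteq> \<zero>\<^bsub>L2_operators M\<^esub>) \<and> \<not> inj_on \<pi> (carrier A))"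
proof -
  obtain code emb where "nat_branching G code emb" using exists_nat_branching[OF assms(1)] by blast
  then interpret nat_branching G code emb .
  obtain \<alpha> v where \<alpha>: "awalk v \<alpha> v" "\<alpha> \<noteq> []" "\<forall>e\<in>set \<alpha>. out_arcs G (tail G e) = {e}"
    using assms(3) by (auto simp: condition_L_def closed_w_def has_exit_def)
  then have v: "v \<in> verts G" by (simp add: awalk_def)
  have A: "cstar_algebra A" and ck: "ck_family G A p s"
    using assms(2) by (simp_all add: graph_cstar_algebra_def)
  let ?rep = "\<lambda>z \<pi>. \<pi> \<in> star_hom A L2N \<and> (\<forall>v\<in>verts G. \<pi> (p v) = op_of (proj_op (D v))) \<and>
    (\<forall>e\<in>arcs G. \<pi> (s e) = op_of (scale_op z (V e)))"
  \<comment> \<open>Universality is applied to \<open>L2N\<close>, which has the required carrier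
    type, for all z of modulus one at once.\<close>
  have rep: "\<exists>!\<pi>. ?rep z \<pi>" if "cmod z = 1" for z
    using assms(2) L2N_cstar_algebra ck_family_twisted[OF that]
    by (simp add: graph_cstar_algebra_def)
  have induced: "induced_representation G A p s nat_count rR rD rfwd rbwd \<pi> \<longleftrightarrow> ?rep 1 \<pi>" for \<pi>
    by (simp add: induced_representation_iff[OF ck])
  let ?w = "foldr (\<lambda>e y. s e \<otimes>\<^bsub>A\<^esub> y) \<alpha> (p v)"
  have word: "\<pi> ?w = op_of (scale_op (z ^ length \<alpha>) (proj_op (D v)))" if "?rep z \<pi>" for z \<pi>
    using that by (intro star_hom_closed_walk[OF A ck _ _ _ \<alpha>(1,3)]) auto
  have p_carrier: "p v \<in> carrier A" using ck v by (simp add: ck_family_def projection_def)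
  have w_carrier: "?w \<in> carrier A"
    using ck \<alpha>(1) by (intro cstar_algebra_foldr_closed[OF A _ p_carrier])
      (auto simp: ck_family_def partial_isometry_def awalk_def)
  have w_neq: "?w \<noteq> p v"
  proof
    assume eq: "?w = p v"
    \<comment> \<open>The angle is chosen so that n steps, n being the length of the cycle, add up
      to pi and hence to -1; n is positive since a closed walk is nonempty.\<close>
    define z where "z = cis (pi / length \<alpha>)"
    have "z ^ length \<alpha> = cis (length \<alpha> * (pi / length \<alpha>))" unfolding z_def by (rule Complex.DeMoivre)
    then have z: "cmod z = 1" "z ^ length \<alpha> = -1" using \<alpha>(2) by (simp_all add: z_def)
    obtain \<pi> where \<pi>: "?rep z \<pi>" using rep[OF z(1)] by blast
    then have "scale_op (-1) (proj_op (D v)) = scale_op 1 (proj_op (D v))"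
      using word[OF \<pi>] eq v by (simp add: z)
    then show False by (subst (asm) scale_proj_op_inject) auto
  qed
  have "\<not> inj_on \<pi> (carrier A)" if "?rep 1 \<pi>" for \<pi>
  proof
    assume "inj_on \<pi> (carrier A)"
    \<comment> \<open>At z = 1 the scalar is 1, so the word and \<open>p v\<close> have the same
      image although they differ in A.\<close>
    moreover have "\<pi> ?w = \<pi> (p v)" using word[OF that] that v by simp
    ultimately show False using w_neq w_carrier p_carrier by (auto dest: inj_onD)
  qed
  moreover have "\<pi> (p u) \<noteq> \<zero>\<^bsub>L2_operators nat_count\<^esub>" if "?rep 1 \<pi>" "u \<in> verts G" for \<pi> u
  proof -
    have "\<zero>\<^bsub>L2_operators nat_count\<^esub> = op_of 0" using L2N_zero by (simp add: L2N_def)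
    moreover have "proj_op (D u) \<noteq> 0" using scale_proj_op_inject[of "D u" 0 1] by auto
    ultimately show ?thesis using that by simp
  qed
  ultimately show ?thesis
    using rep[of 1] sigma_finite_nat_count branching_system
    by (intro exI[of _ nat_count] exI[of _ rR] exI[of _ rD] exI[of _ rfwd] exI[of _ rbwd])
      (simp only: induced, auto)
qed

end
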